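(* Let $M$ be a smooth manifold of dimension $2n+1$ and let $(\varphi,\xi,\eta)$ be an almost contact structure on $M$. Let $J$ be the endomorphism of $TM\times\mathbb{R}$ given by $J(X,f)=(\varphi X-f\xi,\ \eta(X))$, let $F\subset(TM\times\mathbb{R})\otimes\mathbb{C}$ be the sub-bundle with fibres $$F_x=\{J(X,f)_x+\sqrt{-1}\,(X,f)_x : (X,f)\in\Gamma(TM\times\mathbb{R})\},$$ and let $E=F\oplus \mathrm{Ann}(F)\subset\mathcal{E}^1(M)\otimes\mathbb{C}$, where $\mathrm{Ann}(F)\subset(T^*M\times\mathbb{R})\otimes\mathbb{C}$ is the annihilator of $F$. Then $(\varphi,\xi,\eta)$ is normal if and only if the generalized almost contact structure $E$ is integrable.
   Context: An almost contact structure on a smooth manifold $M$ of dimension $2n+1$ is a triple $(\varphi,\xi,\eta)$ with $\varphi$ a $(1,1)$-tensor field, $\xi$ a vector field and $\eta$ a $1$-form such that $\eta(\xi)=1$ and $\varphi^2(X)=-X+\eta(X)\xi$ for all vector fields $X$. It is normal if $N_\varphi(X,Y)+d\eta(X,Y)\xi=0$ for all vector fields $X,Y$, where $$N_\varphi(X,Y)=[\varphi X,\varphi Y]+\varphi^2[X,Y]-\varphi[\varphi X,Y]-\varphi[X,\varphi Y],$$ and $d\eta(X,Y)=X\cdot\eta(Y)-Y\cdot\eta(X)-\eta([X,Y])$. Let $\mathcal{E}^1(M)=(TM\times\mathbb{R})\oplus(T^*M\times\mathbb{R})$; its sections are written $(X,f)+(\alpha,g)$ with $X$ a vector field, $\alpha$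 a $1$-form and $f,g\in C^\infty(M)$. It carries the symmetric bilinear form $$\langle (X_1,f_1)+(\alpha_1,g_1),\,(X_2,f_2)+(\alpha_2,g_2)\rangle=\tfrac12\big(i_{X_2}\alpha_1+i_{X_1}\alpha_2+f_1g_2+f_2g_1\big).$$ The annihilator is taken with respect to the pairing of $T^*M\times\mathbb{R}$ with $TM\times\mathbb{R}$, $((\alpha,g),(X,f))\mapsto\alpha(X)+gf$, extended complex-bilinearly. For $k\ge 1$, $\alpha\in\Omega^k(M)$, $\beta\in\Omega^{k-1}(M)$ put $\widetilde d(\alpha,\beta)=(d\alpha,\,(-1)^k\alpha+d\beta)$, and for $f\in C^\infty(M)$ put $\widetilde d f=(df,f)$. For a vector field $X$ and $f\in C^\infty(M)$ put $i_{(X,f)}(\alpha,\beta)=(i_X\alpha+(-1)^{k+1}f\beta,\ i_X\beta)$ (for $k=1$ this is the function $i_{(X,f)}(\alpha,g)=\alpha(X)+fg$). Put $\widetilde{\mathcal L}_{(X,f)}=i_{(X,f)}\circ\widetilde d+\widetilde d\circ i_{(X,f)}$. The extended Courant bracket on $\Gamma(\mathcal{E}^1(M))$ is $$[(X_1,f_1)+(\alpha_1,g_1),(X_2,f_2)+(\alpha_2,g_2)]=([X_1,X_2],\,X_1\cdot f_2-X_2\cdot f_1)+\widetilde{\mathcal L}_{(X_1,f_1)}(\alpha_2,g_2)-i_{(X_2,f_2)}\widetilde d(\alpha_1,g_1).$$ The form $\langle\cdot,\cdot\rangle$ and the bracket are extended complex-bilinearly to $\mathcal{E}^1(M)\otimes\mathbb{C}$.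 A generalized almost contact structure on a $(2n+1)$-dimensional manifold $M$ is a (complex) sub-bundle $E\subset\mathcal{E}^1(M)\otimes\mathbb{C}$ which is isotropic for $\langle\cdot,\cdot\rangle$ and satisfies $\mathcal{E}^1(M)\otimes\mathbb{C}=E\oplus\overline{E}$, with $\overline{E}$ the complex conjugate of $E$. It is integrable if $\Gamma(E)$ is closed under the extended Courant bracket. The bundle $E=F\oplus\mathrm{Ann}(F)$ associated with an almost contact structure is a generalized almost contact structure. *)

theory Defs
  imports "HOL-Analysis.Analysis" "HOL-Library.Function_Algebras"
begin

text \<open>
  Sums, differences, negatives and zero of functions (hence of tangent vectors, covectors, vector
  fields and forms) are the pointwise ones of \<^theory>\<open>HOL-Library.Function_Algebras\<close>; on pairs
  they are componentwise.
\<close>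

section \<open>Smooth manifolds\<close>

text \<open>Only meaningful for open \<open>S\<close>: derivatives are taken in the ambient space.\<close>

primrec Ck_on :: "nat \<Rightarrow> 'e::euclidean_space set \<Rightarrow> ('e \<Rightarrow> 'b::real_normed_vector) \<Rightarrow> bool" where
  "Ck_on 0 S f \<longleftrightarrow> continuous_on S f"
| "Ck_on (Suc k) S f \<longleftrightarrow>
     (\<forall>x\<in>S. f differentiable (at x)) \<and> (\<forall>v. Ck_on k S (\<lambda>x. frechet_derivative f (at x) v))"

definition smooth_on :: "'e::euclidean_space set \<Rightarrow> ('e \<Rightarrow> 'b::real_normed_vector) \<Rightarrow> bool" where
  "smooth_on S f \<longleftrightarrow> (\<forall>k. Ck_on k S f)"

text \<open>
  A chart is a pair \<open>(U, c)\<close> of an open set and a map whose restriction to \<open>U\<close> is a homeomorphism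
  onto an open set; \<open>c\<close> is irrelevant outside \<open>U\<close>.
\<close>

type_synonym ('a, 'e) chart = "'a set \<times> ('a \<Rightarrow> 'e)"

definition is_chart :: "('a::topological_space, 'e::euclidean_space) chart \<Rightarrow> bool" where
  "is_chart = (\<lambda>(U, c). open U \<and> open (c ` U) \<and> homeomorphism U (c ` U) c (inv_into U c))"

text \<open>
  The manifold is the whole type \<open>'a\<close>, of dimension \<open>DIM('e)\<close>. An atlas need not be
  maximal.
\<close>

definition smooth_manifold ::
  "('a::{t2_space, second_countable_topology}, 'e::euclidean_space) chart set \<Rightarrow> bool" where
  "smooth_manifold A \<longleftrightarrow>
     (\<Union>(U, c)\<in>A. U) = UNIV \<and> (\<forall>C\<in>A. is_chart C) \<and>
     (\<forall>(U, c)\<in>A. \<forall>(V, d)\<in>A. smooth_on (c ` (U \<inter> V)) (d \<circ> inv_into U c))"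

definition smooth_funs :: "('a, 'e::euclidean_space) chart set \<Rightarrow> ('a \<Rightarrow> real) set" where
  "smooth_funs A = {f. \<forall>(U, c)\<in>A. smooth_on (c ` U) (f \<circ> inv_into U c)}"

section \<open>Vector fields, forms and tensor fields\<close>

text \<open>
  Tangent vectors at \<open>p\<close> are the derivations at \<open>p\<close> of the algebra of smooth functions. Elements of
  tangent and cotangent spaces are normalised to vanish outside their domain, so that equality
  of vectors, covectors and forms is equality in HOL.
\<close>

type_synonym 'a tvec = "('a \<Rightarrow> real) \<Rightarrow> real"
type_synonym 'a covec = "'a tvec \<Rightarrow> real"

definition scl :: "real \<Rightarrow> ('b \<Rightarrow> real) \<Rightarrow> 'b \<Rightarrow> real" where
  "scl r v = (\<lambda>f. r * v f)"

definition tangent_space :: "('a, 'e::euclidean_space) chart set \<Rightarrow> 'a \<Rightarrow> 'a tvec set" where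
  "tangent_space A p = {v.
     (\<forall>f\<in>smooth_funs A. \<forall>g\<in>smooth_funs A. v (\<lambda>x. f x + g x) = v f + v g) \<and>
     (\<forall>r. \<forall>f\<in>smooth_funs A. v (\<lambda>x. r * f x) = r * v f) \<and>
     (\<forall>f\<in>smooth_funs A. \<forall>g\<in>smooth_funs A. v (\<lambda>x. f x * g x) = f p * v g + g p * v f) \<and>
     (\<forall>f. f \<notin> smooth_funs A \<longrightarrow> v f = 0)}"

definition cotangent_space :: "('a, 'e::euclidean_space) chart set \<Rightarrow> 'a \<Rightarrow> 'a covec set" where
  "cotangent_space A p = {a.
     (\<forall>v\<in>tangent_space A p. \<forall>w\<in>tangent_space A p. a (v + w) = a v + a w) \<and>
     (\<forall>r. \<forall>v\<in>tangent_space A p. a (scl r v) = r * a v) \<and>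
     (\<forall>v. v \<notin> tangent_space A p \<longrightarrow> a v = 0)}"

text \<open>\<open>ract X f\<close> is the function \<open>X \<cdot> f\<close>.\<close>

definition ract :: "('a \<Rightarrow> 'a tvec) \<Rightarrow> ('a \<Rightarrow> real) \<Rightarrow> 'a \<Rightarrow> real" where
  "ract X f = (\<lambda>p. X p f)"

definition vector_field :: "('a, 'e::euclidean_space) chart set \<Rightarrow> ('a \<Rightarrow> 'a tvec) \<Rightarrow> bool" where
  "vector_field A X \<longleftrightarrow>
     (\<forall>p. X p \<in> tangent_space A p) \<and> (\<forall>f\<in>smooth_funs A. ract X f \<in> smooth_funs A)"

text \<open>\<open>app1 \<alpha> X\<close> is the function \<open>\<alpha>(X)\<close>, \<open>fscl h T\<close> the product of a field by a function.\<close>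

definition app1 :: "('a \<Rightarrow> 'a covec) \<Rightarrow> ('a \<Rightarrow> 'a tvec) \<Rightarrow> 'a \<Rightarrow> real" where
  "app1 \<alpha> X = (\<lambda>p. \<alpha> p (X p))"

definition fscl :: "('a \<Rightarrow> real) \<Rightarrow> ('a \<Rightarrow> 'b \<Rightarrow> real) \<Rightarrow> 'a \<Rightarrow> 'b \<Rightarrow> real" where
  "fscl h T = (\<lambda>p. scl (h p) (T p))"

definition one_form :: "('a, 'e::euclidean_space) chart set \<Rightarrow> ('a \<Rightarrow> 'a covec) \<Rightarrow> bool" where
  "one_form A \<alpha> \<longleftrightarrow>
     (\<forall>p. \<alpha> p \<in> cotangent_space A p) \<and> (\<forall>X. vector_field A X \<longrightarrow> app1 \<alpha> X \<in> smooth_funs A)"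

definition two_form ::
  "('a, 'e::euclidean_space) chart set \<Rightarrow> ('a \<Rightarrow> 'a tvec \<Rightarrow> 'a tvec \<Rightarrow> real) \<Rightarrow> bool" where
  "two_form A \<omega> \<longleftrightarrow>
     (\<forall>p. \<forall>v\<in>tangent_space A p. \<omega> p v \<in> cotangent_space A p) \<and>
     (\<forall>p. \<forall>v\<in>tangent_space A p. \<forall>w\<in>tangent_space A p. \<omega> p v w = - \<omega> p w v) \<and>
     (\<forall>p v. v \<notin> tangent_space A p \<longrightarrow> \<omega> p v = 0) \<and>
     (\<forall>X Y. vector_field A X \<and> vector_field A Y \<longrightarrow> (\<lambda>p. \<omega> p (X p) (Y p)) \<in> smooth_funs A)"

definition lie_bracket :: "('a \<Rightarrow> 'a tvec) \<Rightarrow> ('a \<Rightarrow> 'a tvec) \<Rightarrow> 'a \<Rightarrow> 'a tvec" where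
  "lie_bracket X Y = (\<lambda>p f. X p (ract Y f) - Y p (ract X f))"

definition d0 :: "('a, 'e::euclidean_space) chart set \<Rightarrow> ('a \<Rightarrow> real) \<Rightarrow> 'a \<Rightarrow> 'a covec" where
  "d0 A f = (\<lambda>p v. if v \<in> tangent_space A p then v f else 0)"

text \<open>The function \<open>d\<alpha>(X, Y)\<close>, and the 2-form \<open>d\<alpha>\<close> that it determines.\<close>

definition d1_eval ::
  "('a \<Rightarrow> 'a covec) \<Rightarrow> ('a \<Rightarrow> 'a tvec) \<Rightarrow> ('a \<Rightarrow> 'a tvec) \<Rightarrow> 'a \<Rightarrow> real" where
  "d1_eval \<alpha> X Y = ract X (app1 \<alpha> Y) - ract Y (app1 \<alpha> X) - app1 \<alpha> (lie_bracket X Y)"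

definition d1 :: "('a, 'e::euclidean_space) chart set \<Rightarrow> ('a \<Rightarrow> 'a covec) \<Rightarrow>
    'a \<Rightarrow> 'a tvec \<Rightarrow> 'a tvec \<Rightarrow> real" where
  "d1 A \<alpha> = (THE \<omega>. two_form A \<omega> \<and>
     (\<forall>X Y. vector_field A X \<and> vector_field A Y \<longrightarrow>
        (\<lambda>p. \<omega> p (X p) (Y p)) = d1_eval \<alpha> X Y))"

text \<open>\<open>app11 \<phi> X\<close> is the vector field \<open>\<phi> X\<close>.\<close>

definition app11 :: "('a \<Rightarrow> 'a tvec \<Rightarrow> 'a tvec) \<Rightarrow> ('a \<Rightarrow> 'a tvec) \<Rightarrow> 'a \<Rightarrow> 'a tvec" where
  "app11 \<phi> X = (\<lambda>p. \<phi> p (X p))"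

definition tensor11 ::
  "('a, 'e::euclidean_space) chart set \<Rightarrow> ('a \<Rightarrow> 'a tvec \<Rightarrow> 'a tvec) \<Rightarrow> bool" where
  "tensor11 A \<phi> \<longleftrightarrow>
     (\<forall>p. \<forall>v\<in>tangent_space A p. \<phi> p v \<in> tangent_space A p) \<and>
     (\<forall>p. \<forall>v\<in>tangent_space A p. \<forall>w\<in>tangent_space A p. \<phi> p (v + w) = \<phi> p v + \<phi> p w) \<and>
     (\<forall>p r. \<forall>v\<in>tangent_space A p. \<phi> p (scl r v) = scl r (\<phi> p v)) \<and>
     (\<forall>X. vector_field A X \<longrightarrow> vector_field A (app11 \<phi> X))"

section \<open>Almost contact structures\<close>

definition almost_contact :: "('a, 'e::euclidean_space) chart set \<Rightarrow>
    ('a \<Rightarrow> 'a tvec \<Rightarrow> 'a tvec) \<Rightarrow> ('a \<Rightarrow> 'a tvec) \<Rightarrow> ('a \<Rightarrow> 'a covec) \<Rightarrow> bool" where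
  "almost_contact A \<phi> \<xi> \<eta> \<longleftrightarrow>
     tensor11 A \<phi> \<and> vector_field A \<xi> \<and> one_form A \<eta> \<and>
     app1 \<eta> \<xi> = (\<lambda>p. 1) \<and>
     (\<forall>X. vector_field A X \<longrightarrow> app11 \<phi> (app11 \<phi> X) = - X + fscl (app1 \<eta> X) \<xi>)"

definition nijenhuis :: "('a \<Rightarrow> 'a tvec \<Rightarrow> 'a tvec) \<Rightarrow>
    ('a \<Rightarrow> 'a tvec) \<Rightarrow> ('a \<Rightarrow> 'a tvec) \<Rightarrow> 'a \<Rightarrow> 'a tvec" where
  "nijenhuis \<phi> X Y =
     lie_bracket (app11 \<phi> X) (app11 \<phi> Y) + app11 \<phi> (app11 \<phi> (lie_bracket X Y))
     - app11 \<phi> (lie_bracket (app11 \<phi> X) Y) - app11 \<phi> (lie_bracket X (app11 \<phi> Y))"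

definition normal_almost_contact :: "('a, 'e::euclidean_space) chart set \<Rightarrow>
    ('a \<Rightarrow> 'a tvec \<Rightarrow> 'a tvec) \<Rightarrow> ('a \<Rightarrow> 'a tvec) \<Rightarrow> ('a \<Rightarrow> 'a covec) \<Rightarrow> bool" where
  "normal_almost_contact A \<phi> \<xi> \<eta> \<longleftrightarrow>
     (\<forall>X Y. vector_field A X \<and> vector_field A Y \<longrightarrow>
        nijenhuis \<phi> X Y + fscl (d1_eval \<eta> X Y) \<xi> = 0)"

section \<open>The extended Courant bracket\<close>

text \<open>
  Fibres of \<open>TM \<times> \<real>\<close>, \<open>T\<^sup>*M \<times> \<real>\<close> and \<open>\<E>\<^sup>1(M)\<close>, and the tuples of fields that are their sections;
  \<open>(X, f) + (\<alpha>, g)\<close> is written \<open>((X, f), (\<alpha>, g))\<close>.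
\<close>

type_synonym 'a tr = "'a tvec \<times> real"
type_synonym 'a ctr = "'a covec \<times> real"
type_synonym 'a e1 = "'a tr \<times> 'a ctr"

type_synonym 'a tr_sec = "('a \<Rightarrow> 'a tvec) \<times> ('a \<Rightarrow> real)"
type_synonym 'a ctr_sec = "('a \<Rightarrow> 'a covec) \<times> ('a \<Rightarrow> real)"
type_synonym 'a e1_sec = "'a tr_sec \<times> 'a ctr_sec"

definition tr_sections :: "('a, 'e::euclidean_space) chart set \<Rightarrow> 'a tr_sec set" where
  "tr_sections A = {(X, f). vector_field A X \<and> f \<in> smooth_funs A}"

definition ctr_sections :: "('a, 'e::euclidean_space) chart set \<Rightarrow> 'a ctr_sec set" where
  "ctr_sections A = {(\<alpha>, g). one_form A \<alpha> \<and> g \<in> smooth_funs A}"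

definition e1_sections :: "('a, 'e::euclidean_space) chart set \<Rightarrow> 'a e1_sec set" where
  "e1_sections A = tr_sections A \<times> ctr_sections A"

definition at_pt2 :: "('a \<Rightarrow> 'b) \<times> ('a \<Rightarrow> 'c) \<Rightarrow> 'a \<Rightarrow> 'b \<times> 'c" where
  "at_pt2 s p = (fst s p, snd s p)"

definition e1_at :: "'a e1_sec \<Rightarrow> 'a \<Rightarrow> 'a e1" where
  "e1_at s p = (at_pt2 (fst s) p, at_pt2 (snd s) p)"

text \<open>
  The operator \<open>d\<close>-tilde on functions and on \<open>\<Omega>\<^sup>1 \<times> \<Omega>\<^sup>0\<close>, and \<open>i\<^bsub>(X,f)\<^esub>\<close> on \<open>\<Omega>\<^sup>1 \<times> \<Omega>\<^sup>0\<close> and \<open>\<Omega>\<^sup>2 \<times> \<Omega>\<^sup>1\<close>: these are the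
  only degrees entering the bracket. The signs are \<open>(-1)\<^sup>k\<close> with \<open>k = 1\<close> in \<open>dt1\<close>, and
  \<open>(-1)\<^sup>k\<^sup>+\<^sup>1\<close> with \<open>k = 1, 2\<close> in \<open>it1\<close>, \<open>it2\<close>.
\<close>

definition dt0 :: "('a, 'e::euclidean_space) chart set \<Rightarrow> ('a \<Rightarrow> real) \<Rightarrow> 'a ctr_sec" where
  "dt0 A f = (d0 A f, f)"

definition dt1 :: "('a, 'e::euclidean_space) chart set \<Rightarrow> 'a ctr_sec \<Rightarrow>
    ('a \<Rightarrow> 'a tvec \<Rightarrow> 'a tvec \<Rightarrow> real) \<times> ('a \<Rightarrow> 'a covec)" where
  "dt1 A = (\<lambda>(\<alpha>, g). (d1 A \<alpha>, - \<alpha> + d0 A g))"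

definition it1 :: "'a tr_sec \<Rightarrow> 'a ctr_sec \<Rightarrow> 'a \<Rightarrow> real" where
  "it1 = (\<lambda>(X, f) (\<alpha>, g). app1 \<alpha> X + f * g)"

definition it2 :: "'a tr_sec \<Rightarrow>
    ('a \<Rightarrow> 'a tvec \<Rightarrow> 'a tvec \<Rightarrow> real) \<times> ('a \<Rightarrow> 'a covec) \<Rightarrow> 'a ctr_sec" where
  "it2 = (\<lambda>(X, f) (\<omega>, \<beta>). ((\<lambda>p. \<omega> p (X p)) - fscl f \<beta>, app1 \<beta> X))"

definition lie_tilde ::
  "('a, 'e::euclidean_space) chart set \<Rightarrow> 'a tr_sec \<Rightarrow> 'a ctr_sec \<Rightarrow> 'a ctr_sec" where
  "lie_tilde A s w = it2 s (dt1 A w) + dt0 A (it1 s w)"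

definition courant ::
  "('a, 'e::euclidean_space) chart set \<Rightarrow> 'a e1_sec \<Rightarrow> 'a e1_sec \<Rightarrow> 'a e1_sec" where
  "courant A = (\<lambda>((X1, f1), w1) ((X2, f2), w2).
     ((lie_bracket X1 X2, ract X1 f2 - ract X2 f1),
      lie_tilde A (X1, f1) w2 - it2 (X2, f2) (dt1 A w1)))"

section \<open>Complexification and integrability\<close>

text \<open>\<open>Cx a b\<close> stands for \<open>a + \<i> b\<close> in the complexification of a real vector space or module.\<close>

datatype 'v complexified = Cx (re_part: 'v) (im_part: 'v)

fun courant_C :: "('a, 'e::euclidean_space) chart set \<Rightarrow>
    'a e1_sec complexified \<Rightarrow> 'a e1_sec complexified \<Rightarrow> 'a e1_sec complexified" where
  "courant_C A (Cx s1 t1) (Cx s2 t2) =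
     Cx (courant A s1 s2 - courant A t1 t2) (courant A s1 t2 + courant A t1 s2)"

text \<open>Smooth sections of a family \<open>E\<close> of subsets of the fibres of \<open>\<E>\<^sup>1(M) \<otimes> \<complex>\<close>.\<close>

definition sections_of :: "('a, 'e::euclidean_space) chart set \<Rightarrow>
    ('a \<Rightarrow> 'a e1 complexified set) \<Rightarrow> 'a e1_sec complexified set" where
  "sections_of A E = {Cx s t | s t. s \<in> e1_sections A \<and> t \<in> e1_sections A \<and>
     (\<forall>p. Cx (e1_at s p) (e1_at t p) \<in> E p)}"

definition integrable_bundle ::
  "('a, 'e::euclidean_space) chart set \<Rightarrow> ('a \<Rightarrow> 'a e1 complexified set) \<Rightarrow> bool" where
  "integrable_bundle A E \<longleftrightarrow>
     (\<forall>\<sigma>\<in>sections_of A E. \<forall>\<tau>\<in>sections_of A E. courant_C A \<sigma> \<tau> \<in> sections_of A E)"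

section \<open>The bundle associated with an almost contact structure\<close>

definition J_endo :: "('a \<Rightarrow> 'a tvec \<Rightarrow> 'a tvec) \<Rightarrow> ('a \<Rightarrow> 'a tvec) \<Rightarrow> ('a \<Rightarrow> 'a covec) \<Rightarrow>
    'a \<Rightarrow> 'a tr \<Rightarrow> 'a tr" where
  "J_endo \<phi> \<xi> \<eta> p = (\<lambda>(v, r). (\<phi> p v - scl r (\<xi> p), \<eta> p v))"

definition F_bundle :: "('a, 'e::euclidean_space) chart set \<Rightarrow>
    ('a \<Rightarrow> 'a tvec \<Rightarrow> 'a tvec) \<Rightarrow> ('a \<Rightarrow> 'a tvec) \<Rightarrow> ('a \<Rightarrow> 'a covec) \<Rightarrow>
    'a \<Rightarrow> 'a tr complexified set" where
  "F_bundle A \<phi> \<xi> \<eta> p =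
     {Cx (J_endo \<phi> \<xi> \<eta> p (at_pt2 s p)) (at_pt2 s p) | s. s \<in> tr_sections A}"

definition pairing :: "'a ctr \<Rightarrow> 'a tr \<Rightarrow> real" where
  "pairing = (\<lambda>(a, g) (v, f). a v + g * f)"

fun pairing_C :: "'a ctr complexified \<Rightarrow> 'a tr complexified \<Rightarrow> complex" where
  "pairing_C (Cx a b) (Cx u v) =
     Complex (pairing a u - pairing b v) (pairing a v + pairing b u)"

definition Ann :: "('a, 'e::euclidean_space) chart set \<Rightarrow> ('a \<Rightarrow> 'a tr complexified set) \<Rightarrow>
    'a \<Rightarrow> 'a ctr complexified set" where
  "Ann A F p = {Cx a b | a b. a \<in> cotangent_space A p \<times> UNIV \<and> b \<in> cotangent_space A p \<times> UNIV \<and>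
     (\<forall>u\<in>F p. pairing_C (Cx a b) u = 0)}"

definition direct_sum :: "('a \<Rightarrow> 'a tr complexified set) \<Rightarrow> ('a \<Rightarrow> 'a ctr complexified set) \<Rightarrow>
    'a \<Rightarrow> 'a e1 complexified set" where
  "direct_sum F G p = {Cx (u, a) (v, b) | u v a b. Cx u v \<in> F p \<and> Cx a b \<in> G p}"

definition E_bundle :: "('a, 'e::euclidean_space) chart set \<Rightarrow>
    ('a \<Rightarrow> 'a tvec \<Rightarrow> 'a tvec) \<Rightarrow> ('a \<Rightarrow> 'a tvec) \<Rightarrow> ('a \<Rightarrow> 'a covec) \<Rightarrow>
    'a \<Rightarrow> 'a e1 complexified set" where
  "E_bundle A \<phi> \<xi> \<eta> = direct_sum (F_bundle A \<phi> \<xi> \<eta>) (Ann A (F_bundle A \<phi> \<xi> \<eta>))"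

end

theory Submission
  imports Defs
begin

text \<open>
  On sections of \<open>TM \<times> \<real>\<close> there is a bracket \<open>[(X, f), (Y, g)] = ([X, Y], X \<cdot> g - Y \<cdot> f)\<close>, for which
  \<open>TM \<times> \<real>\<close> is a Lie algebroid, and \<open>J\<close> is an endomorphism with \<open>J\<^sup>2 = - 1\<close> (lemma \<open>J_J\<close>). The bundle \<open>F\<close>
  is the eigenbundle of \<open>J\<close> for \<open>\<i>\<close>, so it is involutive exactly when the Nijenhuis tensor \<open>N\<close> of \<open>J\<close>
  vanishes. Both sides of the equivalence are compared with \<open>N = 0\<close>.

  Integrability (\<open>integrable_iff\<close>): the first component of the extended Courant bracket is the
  bracket of \<open>TM \<times> \<real>\<close>, so involutivity of \<open>E\<close> implies that of \<open>F\<close>. In the other direction, the second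
  component is built from a differential that satisfies a Cartan formula (\<open>it1_dt1\<close>), and the Cartan
  formula shows that brackets of sections of \<open>F \<oplus> Ann(F)\<close> have their second component in \<open>Ann(F)\<close>.

  Normality (\<open>normal_iff\<close>): the normality tensor is the vector field component of \<open>N ((X, 0), (Y, 0))\<close>.
  The other components of \<open>N\<close> are determined by this one, through \<open>N (J s) t = - J (N s t)\<close> and
  antisymmetry.

  Tangent vectors are derivations of the algebra of global smooth functions, and \<open>d\<alpha>\<close> is defined by
  a definite description in terms of its values on vector fields. The Cartan formula is therefore
  available only once \<open>d\<alpha>\<close> is known to exist and to be unique (\<open>d1\<close>). This takes bump functions and
  Hadamard's lemma: together they show that a power of a bump function times a vector field is a
  combination of globally defined coordinate fields, with explicit smooth coefficients
  (\<open>local_frame\<close>). Hence tangent vectors extend to vector fields (\<open>T_extend\<close>) and function-linear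
  operations are pointwise (\<open>tensorial_zero\<close>).
\<close>

section \<open>Differentiability of finite order\<close>

declare Ck_on.simps(2) [simp del]
lemmas Ck_on_Suc = Ck_on.simps(2)

lemma Ck_on_subset: "Ck_on k S f \<Longrightarrow> T \<subseteq> S \<Longrightarrow> Ck_on k T f"
  by (induction k arbitrary: f) (auto simp: Ck_on_Suc intro: continuous_on_subset)

lemma Ck_on_cong:
  assumes "open S" "\<And>x. x \<in> S \<Longrightarrow> f x = g x" "Ck_on k S f"
  shows "Ck_on k S g"
  using assms(2,3)
proof (induction k arbitrary: f g)
  case 0
  then show ?case by (metis Ck_on.simps(1) continuous_on_cong)
next
  case (Suc k)
  have deriv: "(g has_derivative frechet_derivative f (at x)) (at x)" if "x \<in> S" for x
  proof (rule has_derivative_transform_within_open[where f = f])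
    show "(f has_derivative frechet_derivative f (at x)) (at x)"
      using Suc.prems that by (simp add: Ck_on_Suc frechet_derivative_works[symmetric])
  qed (use Suc.prems that assms(1) in auto)
  then have eq: "frechet_derivative f (at x) v = frechet_derivative g (at x) v" if "x \<in> S" for x v
    using frechet_derivative_at[OF deriv[OF that]] by simp
  have "Ck_on k S (\<lambda>x. frechet_derivative g (at x) v)" for v
    by (rule Suc.IH[of "\<lambda>x. frechet_derivative f (at x) v"]) (use Suc.prems eq in \<open>auto simp: Ck_on_Suc\<close>)
  with deriv show ?case by (auto simp: differentiable_def Ck_on_Suc)
qed

text \<open>
  The derivative in the definition of \<open>Ck_on\<close> is a choice operator applied to \<open>f\<close>; this rule replaces
  it by any function known to be the derivative, so that the closure properties below reduce to the
  rules of differentiation.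
\<close>

lemma Ck_on_SucI:
  assumes "open S" "\<And>x. x \<in> S \<Longrightarrow> (f has_derivative f' x) (at x)"
    and "\<And>v. Ck_on k S (\<lambda>x. f' x v)"
  shows "Ck_on (Suc k) S f"
proof -
  have "Ck_on k S (\<lambda>x. frechet_derivative f (at x) v)" for v
    by (rule Ck_on_cong[OF assms(1) _ assms(3)[of v]]) (simp add: frechet_derivative_at[OF assms(2), symmetric])
  with assms(2) show ?thesis by (auto simp: differentiable_def Ck_on_Suc)
qed

lemma Ck_on_has_derivative:
  "Ck_on (Suc k) S f \<Longrightarrow> x \<in> S \<Longrightarrow> (f has_derivative frechet_derivative f (at x)) (at x)"
  by (auto simp: frechet_derivative_works[symmetric] Ck_on_Suc)

lemma Ck_on_derivative: "Ck_on (Suc k) S f \<Longrightarrow> Ck_on k S (\<lambda>x. frechet_derivative f (at x) v)"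
  by (simp add: Ck_on_Suc)

lemma Ck_on_Suc_imp: "Ck_on (Suc k) S f \<Longrightarrow> Ck_on k S f"
proof (induction k arbitrary: f)
  case 0
  then show ?case
    by (auto simp: Ck_on_Suc intro!: continuous_at_imp_continuous_on differentiable_imp_continuous_within)
next
  case (Suc k)
  then show ?case by (metis Ck_on_Suc)
qed

lemma Ck_on_const: "open S \<Longrightarrow> Ck_on k S (\<lambda>x. c)"
proof (induction k arbitrary: c)
  case (Suc k)
  then show ?case by (intro Ck_on_SucI[where f' = "\<lambda>_ _. 0"]) auto
qed auto

lemma Ck_on_linear:
  assumes "open S" "bounded_linear l" shows "Ck_on k S l"
proof (cases k)
  case 0
  then show ?thesis using assms by (simp add: linear_continuous_on)
next
  case (Suc j)
  then show ?thesis
    unfolding Suc using assms by (intro Ck_on_SucI[where f' = "\<lambda>_. l"] Ck_on_const bounded_linear_imp_has_derivative)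
qed

lemma Ck_on_add:
  assumes "open S" "Ck_on k S f" "Ck_on k S g" shows "Ck_on k S (\<lambda>x. f x + g x)"
  using assms(2,3)
proof (induction k arbitrary: f g)
  case 0
  then show ?case by (auto intro: continuous_intros)
next
  case (Suc k)
  show ?case
  proof (rule Ck_on_SucI[where f' = "\<lambda>x v. frechet_derivative f (at x) v + frechet_derivative g (at x) v"])
    show "Ck_on k S (\<lambda>x. frechet_derivative f (at x) v + frechet_derivative g (at x) v)" for v
      by (rule Suc.IH[OF Ck_on_derivative[OF Suc.prems(1)] Ck_on_derivative[OF Suc.prems(2)]])
  qed (rule assms(1), rule has_derivative_add[OF Ck_on_has_derivative[OF Suc.prems(1)] Ck_on_has_derivative[OF Suc.prems(2)]])
qed

lemma Ck_on_bilinear: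
  assumes "bounded_bilinear m" "open S" "Ck_on k S f" "Ck_on k S g"
  shows "Ck_on k S (\<lambda>x. m (f x) (g x))"
  using assms(3,4)
proof (induction k arbitrary: f g)
  case 0
  then show ?case using bounded_bilinear.continuous_on[OF assms(1)] by auto
next
  case (Suc k)
  show ?case
  proof (rule Ck_on_SucI[where f' = "\<lambda>x v. m (f x) (frechet_derivative g (at x) v)
        + m (frechet_derivative f (at x) v) (g x)"])
    show "((\<lambda>x. m (f x) (g x)) has_derivative (\<lambda>v. m (f x) (frechet_derivative g (at x) v)
        + m (frechet_derivative f (at x) v) (g x))) (at x)" if "x \<in> S" for x
      by (intro bounded_bilinear.FDERIV[OF assms(1)] Ck_on_has_derivative[OF Suc.prems(1) that]
          Ck_on_has_derivative[OF Suc.prems(2) that])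
    show "Ck_on k S (\<lambda>x. m (f x) (frechet_derivative g (at x) v)
        + m (frechet_derivative f (at x) v) (g x))" for v
      by (intro Ck_on_add assms(2) Suc.IH[OF Ck_on_Suc_imp[OF Suc.prems(1)] Ck_on_derivative[OF Suc.prems(2)]]
          Suc.IH[OF Ck_on_derivative[OF Suc.prems(1)] Ck_on_Suc_imp[OF Suc.prems(2)]])
  qed (fact assms(2))
qed

lemma Ck_on_sum:
  assumes "open S" "finite I" "\<And>i. i \<in> I \<Longrightarrow> Ck_on k S (f i)"
  shows "Ck_on k S (\<lambda>x. \<Sum>i\<in>I. f i x)"
  using assms(2,3,1) by (induction I rule: finite_induct) (auto intro: Ck_on_const Ck_on_add)

lemma linear_basis_expansion:
  fixes f :: "'e::euclidean_space \<Rightarrow> 'b::real_vector"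
  assumes "linear f" shows "f v = (\<Sum>b\<in>Basis. (v \<bullet> b) *\<^sub>R f b)"
proof -
  have "f v = f (\<Sum>b\<in>Basis. (v \<bullet> b) *\<^sub>R b)" by (simp only: euclidean_representation)
  also have "\<dots> = (\<Sum>b\<in>Basis. (v \<bullet> b) *\<^sub>R f b)"
    by (simp only: linear_sum[OF assms] linear_scale[OF assms])
  finally show ?thesis .
qed

text \<open>
  By the chain rule and linearity, a directional derivative of \<open>f \<circ> g\<close> is the sum over basis vectors
  \<open>b\<close> of the \<open>b\<close>-component of the derivative of \<open>g\<close> times \<open>\<partial>\<^sub>b f \<circ> g\<close>. Each \<open>\<partial>\<^sub>b f\<close> has one degree of
  smoothness less, which makes induction on the order possible although \<open>f\<close> changes.
\<close>

lemma Ck_on_compose: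
  fixes g :: "'e::euclidean_space \<Rightarrow> 'f::euclidean_space"
  assumes "open S" "open T" "g ` S \<subseteq> T" "Ck_on k T f" "Ck_on k S g"
  shows "Ck_on k S (\<lambda>x. f (g x))"
  using assms(4,5)
proof (induction k arbitrary: f)
  case 0
  then show ?case using assms(3) by (auto intro: continuous_on_compose2)
next
  case (Suc k)
  define f' where "f' = (\<lambda>x v. \<Sum>b\<in>Basis. (frechet_derivative g (at x) v \<bullet> b) *\<^sub>R frechet_derivative f (at (g x)) b)"
  show ?case
  proof (rule Ck_on_SucI[OF assms(1), where f' = f'])
    fix x assume x: "x \<in> S"
    then have gx: "g x \<in> T" using assms(3) by auto
    have df: "(f has_derivative frechet_derivative f (at (g x))) (at (g x))"
      using Suc.prems(1) gx by (rule Ck_on_has_derivative)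
    have "f' x = (\<lambda>v. frechet_derivative f (at (g x)) (frechet_derivative g (at x) v))"
      unfolding f'_def by (rule ext, rule linear_basis_expansion[OF has_derivative_linear[OF df], symmetric])
    then show "((\<lambda>x. f (g x)) has_derivative f' x) (at x)"
      using has_derivative_compose[OF Ck_on_has_derivative[OF Suc.prems(2) x] df] by simp
  next
    fix v
    show "Ck_on k S (\<lambda>x. f' x v)"
      unfolding f'_def
    proof (intro Ck_on_sum assms(1) finite_Basis Ck_on_bilinear[OF bounded_bilinear_scaleR])
      fix b :: 'f
      show "Ck_on k S (\<lambda>x. frechet_derivative g (at x) v \<bullet> b)"
        by (intro Ck_on_bilinear[OF bounded_bilinear_inner] assms(1) Ck_on_const Ck_on_derivative[OF Suc.prems(2)])
      show "Ck_on k S (\<lambda>x. frechet_derivative f (at (g x)) b)"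
        by (rule Suc.IH[OF Ck_on_derivative[OF Suc.prems(1)] Ck_on_Suc_imp[OF Suc.prems(2)]])
    qed
  qed
qed

lemma Ck_on_Un:
  assumes "open S" "open T"
  shows "Ck_on k S f \<Longrightarrow> Ck_on k T f \<Longrightarrow> Ck_on k (S \<union> T) f"
  by (induction k arbitrary: f) (use assms in \<open>auto simp: Ck_on_Suc intro: continuous_on_open_Un\<close>)

section \<open>Smooth functions on open subsets of Euclidean space\<close>

lemma smooth_onD: "smooth_on S f \<Longrightarrow> x \<in> S \<Longrightarrow> (f has_derivative frechet_derivative f (at x)) (at x)"
  unfolding smooth_on_def using Ck_on_has_derivative by blast

lemma smooth_on_derivative: "smooth_on S f \<Longrightarrow> smooth_on S (\<lambda>x. frechet_derivative f (at x) v)"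
  unfolding smooth_on_def by (blast intro: Ck_on_derivative)

lemma smooth_on_subset: "smooth_on S f \<Longrightarrow> T \<subseteq> S \<Longrightarrow> smooth_on T f"
  unfolding smooth_on_def using Ck_on_subset by blast

lemma smooth_on_cong: "smooth_on S f \<Longrightarrow> open S \<Longrightarrow> (\<And>x. x \<in> S \<Longrightarrow> f x = g x) \<Longrightarrow> smooth_on S g"
  unfolding smooth_on_def using Ck_on_cong by blast

lemma smooth_on_const: "open S \<Longrightarrow> smooth_on S (\<lambda>x. c)"
  and smooth_on_linear: "open S \<Longrightarrow> bounded_linear l \<Longrightarrow> smooth_on S l"
  and smooth_on_add: "open S \<Longrightarrow> smooth_on S f \<Longrightarrow> smooth_on S g \<Longrightarrow> smooth_on S (\<lambda>x. f x + g x)"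
  and smooth_on_Un: "open S \<Longrightarrow> open T \<Longrightarrow> smooth_on S f \<Longrightarrow> smooth_on T f \<Longrightarrow> smooth_on (S \<union> T) f"
  unfolding smooth_on_def by (auto intro: Ck_on_const Ck_on_linear Ck_on_add Ck_on_Un)

lemma smooth_on_bilinear:
  "bounded_bilinear m \<Longrightarrow> open S \<Longrightarrow> smooth_on S f \<Longrightarrow> smooth_on S g \<Longrightarrow> smooth_on S (\<lambda>x. m (f x) (g x))"
  unfolding smooth_on_def by (auto intro: Ck_on_bilinear)

lemmas smooth_on_mult = smooth_on_bilinear[OF bounded_bilinear_mult]

lemma smooth_on_compose:
  fixes g :: "'e::euclidean_space \<Rightarrow> 'f::euclidean_space"
  shows "open S \<Longrightarrow> open T \<Longrightarrow> g ` S \<subseteq> T \<Longrightarrow> smooth_on T f \<Longrightarrow> smooth_on S g \<Longrightarrow> smooth_on S (\<lambda>x. f (g x))"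
  unfolding smooth_on_def by (auto intro: Ck_on_compose)

section \<open>A smooth bump function\<close>

text \<open>
  The functions \<open>x\<^sup>-\<^sup>n exp (- 1 / x)\<close>, extended by \<open>0\<close> to \<open>x \<le> 0\<close>. The factor \<open>x\<^sup>-\<^sup>n\<close> is carried along
  because the span of the family is closed under differentiation, so that smoothness of all members
  follows from differentiability of each.
\<close>

definition flat :: "nat \<Rightarrow> real \<Rightarrow> real" where
  "flat n x = (if x > 0 then exp (- inverse x) * inverse x ^ n else 0)"

lemma flat_tendsto_0: "(flat n \<longlongrightarrow> 0) (at 0)"
proof -
  have "((\<lambda>x::real. inverse x ^ n / exp (inverse x)) \<longlongrightarrow> 0) (at_right 0)"
    by (rule filterlim_compose[OF tendsto_power_div_exp_0 filterlim_inverse_at_top_right])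
  then have "(flat n \<longlongrightarrow> 0) (at_right 0)"
    by (rule Lim_transform_eventually)
      (auto simp: flat_def eventually_at_filter exp_minus divide_inverse mult.commute)
  moreover have "(flat n \<longlongrightarrow> 0) (at_left 0)"
    by (rule Lim_transform_eventually[OF tendsto_const]) (auto simp: flat_def eventually_at_filter)
  ultimately show ?thesis by (simp add: filterlim_split_at)
qed

lemma flat_has_derivative:
  "(flat n has_derivative (\<lambda>v. v * (flat (n + 2) x - n * flat (n + 1) x))) (at x)"
proof -
  consider "x > 0" | "x < 0" | "x = 0" by linarith
  then have "(flat n has_field_derivative (flat (n + 2) x - n * flat (n + 1) x)) (at x)"
  proof cases
    case 1
    have "((\<lambda>x. exp (- inverse x) * inverse x ^ n) has_field_derivative
        exp (- inverse x) * (inverse x * inverse x) * inverse x ^ n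
        - exp (- inverse x) * (n * inverse x ^ (n - 1) * (inverse x * inverse x))) (at x)"
      using 1 by (auto intro!: derivative_eq_intros simp: power_Suc)
    also have "exp (- inverse x) * (inverse x * inverse x) * inverse x ^ n
        - exp (- inverse x) * (n * inverse x ^ (n - 1) * (inverse x * inverse x))
        = flat (n + 2) x - n * flat (n + 1) x"
      using 1 by (cases n) (simp_all add: flat_def algebra_simps)
    finally have "((\<lambda>x. exp (- inverse x) * inverse x ^ n) has_field_derivative (flat (n + 2) x - n * flat (n + 1) x)) (at x)" .
    then show ?thesis
      by (rule DERIV_cong_ev[THEN iffD1, rotated 3])
        (use 1 eventually_nhds_in_open[of "{0<..}" x] in \<open>auto simp: flat_def elim: eventually_mono\<close>)
  next
    case 2
    have "((\<lambda>x. 0) has_field_derivative (flat (n + 2) x - n * flat (n + 1) x)) (at x)"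
      using 2 by (simp add: flat_def)
    then show ?thesis
      by (rule DERIV_cong_ev[THEN iffD1, rotated 3])
        (use 2 eventually_nhds_in_open[of "{..<0}" x] in \<open>auto simp: flat_def elim: eventually_mono\<close>)
  next
    case 3
    have "(\<lambda>h. (flat n (0 + h) - flat n 0) / h) = flat (n + 1)"
      by (auto simp: flat_def fun_eq_iff divide_inverse)
    then show ?thesis
      using flat_tendsto_0[of "n + 1"] 3 unfolding DERIV_def by (simp add: flat_def)
  qed
  then show ?thesis unfolding has_field_derivative_def by (subst mult.commute)
qed

lemma Ck_on_flat: "Ck_on k UNIV (flat n)"
proof (induction k arbitrary: n)
  case 0
  then show ?case
    by (auto intro!: continuous_at_imp_continuous_on has_derivative_continuous[OF flat_has_derivative])
next
  case (Suc k)
  have "Ck_on k UNIV (\<lambda>x. flat (n + 2) x + (- real n) * flat (n + 1) x)"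
    by (intro Ck_on_add Ck_on_bilinear[OF bounded_bilinear_mult] Ck_on_const Suc) auto
  then show ?case
    by (intro Ck_on_SucI[OF _ flat_has_derivative] Ck_on_bilinear[OF bounded_bilinear_mult] Ck_on_const) auto
qed

text \<open>
  The witness is \<open>exp (- 1 / (r\<^sup>2 - |x - a|\<^sup>2))\<close> inside the ball. It is not normalised and not constant
  near \<open>a\<close>: non-vanishing at \<open>a\<close> suffices for every localisation below, because identities are
  multiplied by powers of the bump function instead of being restricted.
\<close>

lemma bump_exists:
  fixes a :: "'e::euclidean_space"
  assumes "r > 0"
  obtains b :: "'e \<Rightarrow> real" where "smooth_on UNIV b" "b a \<noteq> 0" "\<And>x. x \<notin> cball a r \<Longrightarrow> b x = 0"
proof
  let ?b = "\<lambda>x::'e. flat 0 (r\<^sup>2 + (- 1) * ((x + (- a)) \<bullet> (x + (- a))))"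
  show "smooth_on UNIV ?b"
  proof (rule smooth_on_compose[where T = UNIV and f = "flat 0"])
    show "smooth_on UNIV (\<lambda>x. r\<^sup>2 + (- 1) * ((x + (- a)) \<bullet> (x + (- a))))"
      by (intro smooth_on_add smooth_on_mult smooth_on_bilinear[OF bounded_bilinear_inner]
          smooth_on_const smooth_on_linear[of _ "\<lambda>x. x"] bounded_linear_ident open_UNIV)
  qed (auto simp: smooth_on_def Ck_on_flat)
  show "?b a \<noteq> 0" using assms by (simp add: flat_def)
  show "?b x = 0" if "x \<notin> cball a r" for x
  proof -
    have "r < norm (x - a)" using that by (simp add: dist_norm norm_minus_commute)
    then have "r\<^sup>2 \<le> (norm (x - a))\<^sup>2" using assms by (intro power_mono) auto
    then show ?thesis by (simp add: flat_def power2_norm_eq_inner)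
  qed
qed

section \<open>Hadamard's lemma\<close>

text \<open>
  Differentiation under the integral sign brings out one more factor \<open>t\<close> and replaces \<open>h\<close> by a
  directional derivative of \<open>h\<close>. The exponent \<open>m\<close> is there so that the derivative is an integral of
  the same kind, and the induction of \<open>Ck_on_segment_integral\<close> goes through.
\<close>

lemma segment_integral_has_derivative:
  fixes h :: "'e::euclidean_space \<Rightarrow> real"
  assumes "convex S" "open S" "z \<in> S" "Ck_on (Suc 0) S h" "y \<in> S"
  shows "((\<lambda>y. integral {0..1} (\<lambda>t. t ^ m * h (z + t *\<^sub>R (y - z)))) has_derivative
    (\<lambda>v. integral {0..1} (\<lambda>t. t ^ Suc m * frechet_derivative h (at (z + t *\<^sub>R (y - z))) v))) (at y)"
proof -
  have inS: "z + t *\<^sub>R (y - z) \<in> S" if "y \<in> S" "t \<in> {0..1}" for y t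
    using convexD_alt[OF assms(1,3) that(1), of t] that(2) by (simp add: algebra_simps)
  define D where "D = (\<lambda>y. \<Sum>b\<in>Basis. frechet_derivative h (at y) b *\<^sub>R blinfun_inner_left b)"
  have D: "frechet_derivative h (at y) v = blinfun_apply (D y) v" if "y \<in> S" for y v
  proof -
    have lin: "linear (frechet_derivative h (at y))"
      using Ck_on_has_derivative[OF assms(4) that] by (rule has_derivative_linear)
    show ?thesis
      unfolding D_def blinfun.sum_left blinfun.scaleR_left linear_basis_expansion[OF lin, of v]
      by (simp add: mult.commute inner_commute)
  qed
  have contD: "continuous_on S D"
    unfolding D_def using Ck_on_derivative[OF assms(4)] by (auto intro!: continuous_intros)
  have conth: "continuous_on S h" using Ck_on_Suc_imp[OF assms(4)] by simp
  define fx where "fx = (\<lambda>y t. t ^ Suc m *\<^sub>R D (z + t *\<^sub>R (y - z)))"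
  have "((\<lambda>y. integral (cbox 0 1) (\<lambda>t. t ^ m * h (z + t *\<^sub>R (y - z)))) has_derivative
     integral (cbox 0 1) (fx y)) (at y within S)"
  proof (rule leibniz_rule)
    fix y t assume yt: "y \<in> S" "t \<in> cbox 0 (1::real)"
    then have s: "z + t *\<^sub>R (y - z) \<in> S" using inS by auto
    have "(h has_derivative blinfun_apply (D (z + t *\<^sub>R (y - z)))) (at (z + t *\<^sub>R (y - z)))"
      using Ck_on_has_derivative[OF assms(4) s] unfolding ext[OF D[OF s], symmetric] by simp
    moreover have "((\<lambda>y. z + t *\<^sub>R (y - z)) has_derivative (\<lambda>v. t *\<^sub>R v)) (at y within S)"
      by (auto intro!: derivative_eq_intros)
    ultimately have "((\<lambda>y. h (z + t *\<^sub>R (y - z))) has_derivative (\<lambda>v. blinfun_apply (D (z + t *\<^sub>R (y - z))) (t *\<^sub>R v))) (at y within S)"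
      using has_derivative_compose[of "\<lambda>y. z + t *\<^sub>R (y - z)" _ y S h] by blast
    then show "((\<lambda>y. t ^ m * h (z + t *\<^sub>R (y - z))) has_derivative blinfun_apply (fx y t)) (at y within S)"
      unfolding fx_def
      by (auto intro!: derivative_eq_intros simp: blinfun.scaleR_left blinfun.scaleR_right)
  next
    fix y assume "y \<in> S"
    then show "(\<lambda>t. t ^ m * h (z + t *\<^sub>R (y - z))) integrable_on cbox 0 1"
      using inS by (intro integrable_continuous continuous_intros continuous_on_compose2[OF conth]) auto
  next
    show "continuous_on (S \<times> cbox 0 1) (\<lambda>(y, t). fx y t)"
      unfolding fx_def split_beta
      using inS by (intro continuous_intros continuous_on_compose2[OF contD]) auto
  qed fact+
  moreover have "blinfun_apply (integral (cbox 0 1) (fx y)) =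
      (\<lambda>v. integral {0..1} (\<lambda>t. t ^ Suc m * frechet_derivative h (at (z + t *\<^sub>R (y - z))) v))"
  proof
    fix v
    have "fx y integrable_on cbox 0 1"
      unfolding fx_def using inS assms(5)
      by (intro integrable_continuous continuous_intros continuous_on_compose2[OF contD]) auto
    then have "blinfun_apply (integral (cbox 0 1) (fx y)) v = integral (cbox 0 1) (\<lambda>t. blinfun_apply (fx y t) v)"
      by (rule blinfun_apply_integral)
    also have "\<dots> = integral {0..1} (\<lambda>t. t ^ Suc m * frechet_derivative h (at (z + t *\<^sub>R (y - z))) v)"
      unfolding cbox_interval
      by (rule integral_cong) (use inS assms(5) D in \<open>auto simp: fx_def blinfun.scaleR_left\<close>)
    finally show "blinfun_apply (integral (cbox 0 1) (fx y)) v = \<dots>" .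
  qed
  ultimately show ?thesis
    using at_within_open[OF assms(5,2)] by (simp only: cbox_interval)
qed

lemma Ck_on_segment_integral:
  fixes h :: "'e::euclidean_space \<Rightarrow> real"
  assumes "convex S" "open S" "z \<in> S" "smooth_on S h"
  shows "Ck_on k S (\<lambda>y. integral {0..1} (\<lambda>t. t ^ m * h (z + t *\<^sub>R (y - z))))"
  using assms(4)
proof (induction k arbitrary: h m)
  case 0
  then have "Ck_on (Suc 0) S h" by (simp add: smooth_on_def)
  from segment_integral_has_derivative[OF assms(1-3) this] show ?case
    by (auto intro!: continuous_at_imp_continuous_on has_derivative_continuous)
next
  case (Suc k)
  then have "Ck_on (Suc 0) S h" unfolding smooth_on_def by blast
  from segment_integral_has_derivative[OF assms(1-3) this] show ?case
    by (rule Ck_on_SucI[OF assms(2)]) (assumption, rule Suc.IH[OF smooth_on_derivative[OF Suc.prems]])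
qed

text \<open>
  Hadamard's lemma, with \<open>g\<^sub>i(y) = \<integral> \<partial>\<^sub>i f (z + t (y - z)) dt\<close> over \<open>[0, 1]\<close>: integrate the derivative of \<open>f\<close>
  along the segment from \<open>z\<close> to \<open>y\<close>. Smoothness of \<open>g\<^sub>i\<close> is what lets a derivation at \<open>z\<close> be applied to
  the right-hand side.
\<close>

lemma hadamard:
  fixes f :: "'e::euclidean_space \<Rightarrow> real"
  assumes "convex S" "open S" "z \<in> S" "smooth_on S f"
  obtains g :: "'e \<Rightarrow> 'e \<Rightarrow> real"
  where "\<And>i. smooth_on S (g i)" "\<And>i. g i z = frechet_derivative f (at z) i"
    "\<And>y. y \<in> S \<Longrightarrow> f y = f z + (\<Sum>i\<in>Basis. ((y - z) \<bullet> i) * g i y)"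
proof
  let ?g = "\<lambda>i y. integral {0..1} (\<lambda>t. t ^ 0 * frechet_derivative f (at (z + t *\<^sub>R (y - z))) i)"
  show "smooth_on S (?g i)" for i
    unfolding smooth_on_def
    using Ck_on_segment_integral[OF assms(1-3) smooth_on_derivative[OF assms(4)], where m = 0] by blast
  show "?g i z = frechet_derivative f (at z) i" for i by simp
  fix y assume y: "y \<in> S"
  have inS: "z + t *\<^sub>R (y - z) \<in> S" if "t \<in> {0..1}" for t
    using convexD_alt[OF assms(1,3) y, of t] that by (simp add: algebra_simps)
  let ?F = "\<lambda>t. frechet_derivative f (at (z + t *\<^sub>R (y - z)))"
  have "((\<lambda>t. ?F t (y - z)) has_integral f (z + 1 *\<^sub>R (y - z)) - f (z + 0 *\<^sub>R (y - z))) {0..1}"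
  proof (rule fundamental_theorem_of_calculus)
    fix t :: real assume t: "t \<in> {0..1}"
    have df: "(f has_derivative ?F t) (at (z + t *\<^sub>R (y - z)))" using smooth_onD[OF assms(4) inS[OF t]] .
    have "((\<lambda>t. z + t *\<^sub>R (y - z)) has_derivative (\<lambda>s. s *\<^sub>R (y - z))) (at t within {0..1})"
      by (auto intro!: derivative_eq_intros)
    with df have "((\<lambda>t. f (z + t *\<^sub>R (y - z))) has_derivative (\<lambda>s. ?F t (s *\<^sub>R (y - z)))) (at t within {0..1})"
      using has_derivative_compose[of "\<lambda>t. z + t *\<^sub>R (y - z)" _ t "{0..1}" f] by blast
    then show "((\<lambda>t. f (z + t *\<^sub>R (y - z))) has_vector_derivative ?F t (y - z)) (at t within {0..1})"
      using linear_scale[OF has_derivative_linear[OF df]] by (simp add: has_vector_derivative_def)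
  qed simp
  then have "f y - f z = integral {0..1} (\<lambda>t. ?F t (y - z))" by (auto dest: integral_unique)
  also have "\<dots> = integral {0..1} (\<lambda>t. \<Sum>i\<in>Basis. ((y - z) \<bullet> i) * ?F t i)"
  proof (rule integral_cong)
    fix t :: real assume t: "t \<in> {0..1}"
    show "?F t (y - z) = (\<Sum>i\<in>Basis. ((y - z) \<bullet> i) * ?F t i)"
      using linear_basis_expansion[OF has_derivative_linear[OF smooth_onD[OF assms(4) inS[OF t]]], of "y - z"]
      unfolding real_scaleR_def .
  qed
  also have "\<dots> = (\<Sum>i\<in>Basis. integral {0..1} (\<lambda>t. ((y - z) \<bullet> i) * ?F t i))"
  proof (rule integral_sum)
    fix i :: 'e
    have "continuous_on S (\<lambda>x. frechet_derivative f (at x) i)"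
      using smooth_on_derivative[OF assms(4)] unfolding smooth_on_def by (metis Ck_on.simps(1))
    then have "continuous_on {0..1} (\<lambda>t. ?F t i)"
      by (rule continuous_on_compose2) (use inS in \<open>auto intro!: continuous_intros\<close>)
    then show "(\<lambda>t. ((y - z) \<bullet> i) * ?F t i) integrable_on {0..1}"
      by (intro integrable_continuous_real continuous_intros)
  qed simp
  finally show "f y = f z + (\<Sum>i\<in>Basis. ((y - z) \<bullet> i) * ?g i y)" by simp
qed

lemma sum_fun_apply: "(\<Sum>i\<in>I. V i) x = (\<Sum>i\<in>I. V i x)"
  by (induction I rule: infinite_finite_induct) auto

lemma scl_apply [simp]: "scl r v f = r * v f"
  by (simp add: scl_def)

lemma fscl_apply [simp]: "fscl h T p = scl (h p) (T p)"
  and ract_apply [simp]: "ract X f p = X p f"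
  and app1_apply [simp]: "app1 \<alpha> X p = \<alpha> p (X p)"
  and app11_apply [simp]: "app11 \<phi> X p = \<phi> p (X p)"
  and lie_bracket_apply [simp]: "lie_bracket X Y p f = X p (ract Y f) - Y p (ract X f)"
  by (simp_all add: fscl_def ract_def app1_def app11_def lie_bracket_def)

locale smooth_mfd =
  fixes A :: "('a::{t2_space, second_countable_topology}, 'e::euclidean_space) chart set"
  assumes smooth_manifold: "smooth_manifold A"
begin

abbreviation "R \<equiv> smooth_funs A"
abbreviation "T \<equiv> tangent_space A"
abbreviation "Tstar \<equiv> cotangent_space A"
abbreviation "VF \<equiv> vector_field A"
abbreviation "OF1 \<equiv> one_form A"

section \<open>Smooth functions on a manifold\<close>

lemma chartD:
  assumes "(U, c) \<in> A"
  shows "open U" "open (c ` U)" "continuous_on U c" "continuous_on (c ` U) (inv_into U c)" "inj_on c U"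
proof -
  have "is_chart (U, c)" using assms smooth_manifold unfolding smooth_manifold_def by blast
  then have *: "open U" "open (c ` U)" "homeomorphism U (c ` U) c (inv_into U c)"
    by (auto simp: is_chart_def)
  then show "open U" "open (c ` U)" "continuous_on U c" "continuous_on (c ` U) (inv_into U c)"
    by (auto simp: homeomorphism_def)
  show "inj_on c U" using *(3) by (intro inj_on_inverseI[of U "inv_into U c" c]) (simp add: homeomorphism_def)
qed

lemma chart_image_open:
  assumes "(V, d) \<in> A" "open W" shows "open (d ` (V \<inter> W))"
proof -
  note V = chartD[OF assms(1)]
  have "d ` (V \<inter> W) = d ` V \<inter> inv_into V d -` W"
  proof
    show "d ` (V \<inter> W) \<subseteq> d ` V \<inter> inv_into V d -` W"
      using V(5) by (auto simp: inv_into_f_f)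
    show "d ` V \<inter> inv_into V d -` W \<subseteq> d ` (V \<inter> W)"
      using V(5) by (clarsimp simp: inv_into_f_f)
  qed
  then show ?thesis
    using continuous_open_preimage[OF V(4,2) assms(2)] by simp
qed

lemma chart_cover: obtains U c where "(U, c) \<in> A" "p \<in> U"
  using smooth_manifold unfolding smooth_manifold_def by (metis (no_types, lifting) UNIV_I UN_iff case_prod_beta prod.collapse)

lemma transition_smooth: "(U, c) \<in> A \<Longrightarrow> (V, d) \<in> A \<Longrightarrow> smooth_on (c ` (U \<inter> V)) (d \<circ> inv_into U c)"
  using smooth_manifold unfolding smooth_manifold_def by (elim conjE) (drule (1) bspec, simp, drule (1) bspec, simp)

lemma R_iff: "f \<in> R \<longleftrightarrow> (\<forall>(U, c)\<in>A. smooth_on (c ` U) (\<lambda>y. f (inv_into U c y)))"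
  by (simp add: smooth_funs_def o_def)

lemma R_chart: "f \<in> R \<Longrightarrow> (U, c) \<in> A \<Longrightarrow> smooth_on (c ` U) (\<lambda>y. f (inv_into U c y))"
  by (auto simp: R_iff)

lemma R_const: "(\<lambda>_. r) \<in> R"
  and R_add: "f \<in> R \<Longrightarrow> g \<in> R \<Longrightarrow> f + g \<in> R"
  and R_mult: "f \<in> R \<Longrightarrow> g \<in> R \<Longrightarrow> f * g \<in> R"
  by (fastforce simp: R_iff intro: smooth_on_const smooth_on_add smooth_on_mult chartD)+

lemma R_zero: "0 \<in> R" and R_one: "1 \<in> R"
  using R_const[of 0] R_const[of 1] by (simp_all add: zero_fun_def one_fun_def)

lemma R_uminus: "f \<in> R \<Longrightarrow> - f \<in> R"
  using R_mult[OF R_const[of "-1"], of f] by (simp add: times_fun_def fun_Compl_def)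

lemma R_diff: "f \<in> R \<Longrightarrow> g \<in> R \<Longrightarrow> f - g \<in> R"
  using R_add[OF _ R_uminus, of f g] by simp

lemma R_sum: "finite I \<Longrightarrow> (\<And>i. i \<in> I \<Longrightarrow> f i \<in> R) \<Longrightarrow> sum f I \<in> R"
  by (induction I rule: finite_induct) (auto intro: R_zero R_add)

lemmas R_intros = R_const R_zero R_one R_add R_mult R_uminus R_diff

section \<open>Tangent vectors\<close>

lemma T_add: "v \<in> T p \<Longrightarrow> f \<in> R \<Longrightarrow> g \<in> R \<Longrightarrow> v (f + g) = v f + v g"
  and T_mult: "v \<in> T p \<Longrightarrow> f \<in> R \<Longrightarrow> g \<in> R \<Longrightarrow> v (f * g) = f p * v g + g p * v f"
  and T_nonsmooth: "v \<in> T p \<Longrightarrow> f \<notin> R \<Longrightarrow> v f = 0"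
  by (simp_all add: tangent_space_def plus_fun_def times_fun_def)

lemma T_scale: "v \<in> T p \<Longrightarrow> f \<in> R \<Longrightarrow> v ((\<lambda>_. r) * f) = r * v f"
  by (simp add: tangent_space_def times_fun_def)

lemma T_one: "v \<in> T p \<Longrightarrow> v 1 = 0"
  using T_mult[of v p 1 1] R_one by simp

lemma T_const: "v \<in> T p \<Longrightarrow> v (\<lambda>_. r) = 0"
  using T_scale[of v p 1 r] T_one R_one by simp

lemma T_zero_fun: "v \<in> T p \<Longrightarrow> v 0 = 0"
  using T_const[of v p 0] by (simp add: zero_fun_def)

lemma T_uminus: "v \<in> T p \<Longrightarrow> f \<in> R \<Longrightarrow> v (- f) = - v f"
  using T_scale[of v p f "-1"] by (simp add: times_fun_def fun_Compl_def)

lemma T_diff: "v \<in> T p \<Longrightarrow> f \<in> R \<Longrightarrow> g \<in> R \<Longrightarrow> v (f - g) = v f - v g"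
  using T_add[of v p f "- g"] T_uminus[of v p g] R_uminus by simp

lemma T_sum: "finite I \<Longrightarrow> (\<And>i. i \<in> I \<Longrightarrow> f i \<in> R) \<Longrightarrow> v \<in> T p \<Longrightarrow> v (sum f I) = (\<Sum>i\<in>I. v (f i))"
  by (induction I rule: finite_induct) (auto simp: T_zero_fun T_add R_sum)

lemma TI:
  assumes "\<And>f g. f \<in> R \<Longrightarrow> g \<in> R \<Longrightarrow> v (f + g) = v f + v g"
    and "\<And>r f. f \<in> R \<Longrightarrow> v ((\<lambda>_. r) * f) = r * v f"
    and "\<And>f g. f \<in> R \<Longrightarrow> g \<in> R \<Longrightarrow> v (f * g) = f p * v g + g p * v f"
    and "\<And>f. f \<notin> R \<Longrightarrow> v f = 0"
  shows "v \<in> T p"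
  using assms by (simp add: tangent_space_def plus_fun_def times_fun_def)

lemma T_closed_add: "v \<in> T p \<Longrightarrow> w \<in> T p \<Longrightarrow> v + w \<in> T p"
  and T_closed_scl: "v \<in> T p \<Longrightarrow> scl r v \<in> T p"
  by (auto intro!: TI simp: T_add T_scale T_mult T_nonsmooth distrib_left distrib_right mult.left_commute)

lemma T_closed_zero: "0 \<in> T p"
  by (auto intro!: TI)

lemma scl_minus_one: "scl (- 1) v = - v"
  by (simp add: fun_eq_iff)

lemma T_closed_uminus: "v \<in> T p \<Longrightarrow> - v \<in> T p"
  using T_closed_scl[of v p "-1"] by (simp add: scl_minus_one)

lemma T_eqI:
  assumes "v \<in> T p" "w \<in> T p" "\<And>f. f \<in> R \<Longrightarrow> v f = w f" shows "v = w"
proof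
  fix f show "v f = w f"
    using assms T_nonsmooth[of v p f] T_nonsmooth[of w p f] by (cases "f \<in> R") auto
qed

text \<open>
  Tangent vectors vanish on non-smooth functions by convention. Iterated derivatives inherit this, so
  that a Lie bracket has values in the tangent spaces.
\<close>

lemma T_ract:
  assumes "v \<in> T p" "VF X" "f \<notin> R" shows "v (ract X f) = 0"
proof -
  have "ract X f = 0" using assms T_nonsmooth by (auto simp: fun_eq_iff vector_field_def)
  with assms show ?thesis by (simp add: T_zero_fun)
qed

section \<open>Covectors\<close>

lemma Tstar_add: "a \<in> Tstar p \<Longrightarrow> v \<in> T p \<Longrightarrow> w \<in> T p \<Longrightarrow> a (v + w) = a v + a w"
  and Tstar_scl: "a \<in> Tstar p \<Longrightarrow> v \<in> T p \<Longrightarrow> a (scl r v) = r * a v"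
  and Tstar_outside: "a \<in> Tstar p \<Longrightarrow> v \<notin> T p \<Longrightarrow> a v = 0"
  by (simp_all add: cotangent_space_def)

lemma Tstar_uminus: "a \<in> Tstar p \<Longrightarrow> v \<in> T p \<Longrightarrow> a (- v) = - a v"
  using Tstar_scl[of a p v "-1"] by (simp add: scl_minus_one)

lemma Tstar_diff: "a \<in> Tstar p \<Longrightarrow> v \<in> T p \<Longrightarrow> w \<in> T p \<Longrightarrow> a (v - w) = a v - a w"
  using Tstar_add[of a p v "- w"] Tstar_uminus[of a p w] T_closed_uminus[of w p] by simp

lemma Tstar_closed_add: "a \<in> Tstar p \<Longrightarrow> b \<in> Tstar p \<Longrightarrow> a + b \<in> Tstar p"
  and Tstar_closed_scl: "a \<in> Tstar p \<Longrightarrow> scl r a \<in> Tstar p"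
  by (simp_all add: cotangent_space_def algebra_simps)

section \<open>Vector fields and the Lie bracket\<close>

lemma VF_T: "VF X \<Longrightarrow> X p \<in> T p"
  and VF_R: "VF X \<Longrightarrow> f \<in> R \<Longrightarrow> ract X f \<in> R"
  by (simp_all add: vector_field_def)

lemma ract_linear:
  "ract (X + Y) f = ract X f + ract Y f" "ract (fscl h X) f = h * ract X f"
  by (simp_all add: fun_eq_iff)

lemma VF_add: "VF X \<Longrightarrow> VF Y \<Longrightarrow> VF (X + Y)"
  and VF_fscl: "h \<in> R \<Longrightarrow> VF X \<Longrightarrow> VF (fscl h X)"
  by (simp_all add: vector_field_def T_closed_add T_closed_scl R_add R_mult ract_linear)

lemma VF_zero: "VF 0"
proof -
  have "ract 0 f = 0" for f :: "'a \<Rightarrow> real" by (simp add: fun_eq_iff)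
  then show ?thesis by (simp add: vector_field_def T_closed_zero R_zero)
qed

lemma VF_uminus: "VF X \<Longrightarrow> VF (- X)"
  using VF_fscl[OF R_const[of "-1"], of X] by (simp add: fscl_def scl_minus_one fun_Compl_def)

lemma VF_diff: "VF X \<Longrightarrow> VF Y \<Longrightarrow> VF (X - Y)"
  using VF_add[OF _ VF_uminus, of X Y] by simp

lemma VF_sum: "finite I \<Longrightarrow> (\<And>i. i \<in> I \<Longrightarrow> VF (X i)) \<Longrightarrow> VF (sum X I)"
  by (induction I rule: finite_induct) (auto intro: VF_zero VF_add)

lemma VF_lie: assumes "VF X" "VF Y" shows "VF (lie_bracket X Y)"
proof -
  note X = VF_T[OF assms(1)] VF_R[OF assms(1)] and Y = VF_T[OF assms(2)] VF_R[OF assms(2)]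
  have ract: "ract Z (f + g) = ract Z f + ract Z g" "ract Z (f * g) = f * ract Z g + g * ract Z f"
    "ract Z ((\<lambda>_. r) * f) = (\<lambda>_. r) * ract Z f"
    if "VF Z" "f \<in> R" "g \<in> R" for Z f g r
    using that by (auto simp: fun_eq_iff T_add[OF VF_T] T_mult[OF VF_T] T_scale[OF VF_T])
  have "lie_bracket X Y p \<in> T p" for p
  proof (rule TI)
    fix f g assume fg: "f \<in> R" "g \<in> R"
    show "lie_bracket X Y p (f + g) = lie_bracket X Y p f + lie_bracket X Y p g"
      using fg by (simp add: ract assms T_add[OF X(1)] T_add[OF Y(1)] X Y)
    show "lie_bracket X Y p (f * g) = f p * lie_bracket X Y p g + g p * lie_bracket X Y p f"
      using fg by (simp add: ract assms T_add[OF X(1)] T_add[OF Y(1)]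
          T_mult[OF X(1)] T_mult[OF Y(1)] X Y R_mult algebra_simps)
    show "lie_bracket X Y p ((\<lambda>_. r) * f) = r * lie_bracket X Y p f" for r
      using fg by (simp add: ract(3)[OF _ _ R_zero] assms T_scale[OF X(1)] T_scale[OF Y(1)] X Y right_diff_distrib)
  next
    fix f assume "f \<notin> R"
    then show "lie_bracket X Y p f = 0"
      using T_ract[OF X(1) assms(2)] T_ract[OF Y(1) assms(1)] by simp
  qed
  moreover have "ract (lie_bracket X Y) f = ract X (ract Y f) - ract Y (ract X f)" for f
    by (simp add: fun_eq_iff)
  ultimately show ?thesis by (simp add: vector_field_def R_diff X Y)
qed

lemma VF_eqI:
  assumes "VF X" "VF Y" "\<And>p f. f \<in> R \<Longrightarrow> X p f = Y p f" shows "X = Y"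
  by (rule ext, rule T_eqI) (use assms VF_T in auto)

lemma lie_anti: "lie_bracket X Y = - lie_bracket Y X"
  by (simp add: fun_eq_iff)

lemma lie_add_left:
  assumes "VF X" "VF X'" "VF Y"
  shows "lie_bracket (X + X') Y = lie_bracket X Y + lie_bracket X' Y"
  by (rule VF_eqI)
    (use assms in \<open>auto simp: ract_linear T_add[OF VF_T] VF_R intro!: VF_lie VF_add\<close>)

lemma lie_fscl_left:
  assumes "VF X" "VF Y" "h \<in> R"
  shows "lie_bracket (fscl h X) Y = fscl h (lie_bracket X Y) - fscl (ract Y h) X"
  by (rule VF_eqI)
    (use assms in \<open>auto simp: ract_linear T_mult[OF VF_T] VF_R algebra_simps
      intro!: VF_lie VF_fscl VF_diff\<close>)

section \<open>One-forms\<close>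

lemma OF1_T: "OF1 \<alpha> \<Longrightarrow> \<alpha> p \<in> Tstar p"
  and OF1_R: "OF1 \<alpha> \<Longrightarrow> VF X \<Longrightarrow> app1 \<alpha> X \<in> R"
  by (simp_all add: one_form_def)

lemma app1_linear:
  "app1 (\<alpha> + \<beta>) X = app1 \<alpha> X + app1 \<beta> X" "app1 (fscl h \<alpha>) X = h * app1 \<alpha> X"
  "app1 (- \<alpha>) X = - app1 \<alpha> X" "app1 (\<alpha> - \<beta>) X = app1 \<alpha> X - app1 \<beta> X"
  by (simp_all add: fun_eq_iff)

lemma app1_add: "OF1 \<alpha> \<Longrightarrow> VF X \<Longrightarrow> VF Y \<Longrightarrow> app1 \<alpha> (X + Y) = app1 \<alpha> X + app1 \<alpha> Y"
  and app1_diff: "OF1 \<alpha> \<Longrightarrow> VF X \<Longrightarrow> VF Y \<Longrightarrow> app1 \<alpha> (X - Y) = app1 \<alpha> X - app1 \<alpha> Y"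
  and app1_uminus: "OF1 \<alpha> \<Longrightarrow> VF X \<Longrightarrow> app1 \<alpha> (- X) = - app1 \<alpha> X"
  and app1_fscl: "OF1 \<alpha> \<Longrightarrow> VF X \<Longrightarrow> app1 \<alpha> (fscl h X) = h * app1 \<alpha> X"
  by (simp_all add: fun_eq_iff Tstar_add[OF OF1_T VF_T VF_T] Tstar_diff[OF OF1_T VF_T VF_T]
      Tstar_uminus[OF OF1_T VF_T] Tstar_scl[OF OF1_T VF_T])

lemma OF1_add: "OF1 \<alpha> \<Longrightarrow> OF1 \<beta> \<Longrightarrow> OF1 (\<alpha> + \<beta>)"
  and OF1_fscl: "h \<in> R \<Longrightarrow> OF1 \<alpha> \<Longrightarrow> OF1 (fscl h \<alpha>)"
  by (simp_all add: one_form_def Tstar_closed_add Tstar_closed_scl app1_linear R_add R_mult)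

lemma OF1_uminus: "OF1 \<alpha> \<Longrightarrow> OF1 (- \<alpha>)"
  using OF1_fscl[OF R_const[of "-1"], of \<alpha>] by (simp add: fscl_def scl_minus_one fun_Compl_def)

lemma OF1_diff: "OF1 \<alpha> \<Longrightarrow> OF1 \<beta> \<Longrightarrow> OF1 (\<alpha> - \<beta>)"
  using OF1_add[OF _ OF1_uminus, of \<alpha> \<beta>] by simp

lemma OF1_zero: "OF1 0"
proof -
  have "app1 0 X = 0" for X :: "'a \<Rightarrow> 'a tvec" by (simp add: fun_eq_iff)
  then show ?thesis by (simp add: one_form_def R_zero cotangent_space_def)
qed

lemma app1_d0: "VF X \<Longrightarrow> app1 (d0 A f) X = ract X f"
  by (simp add: fun_eq_iff d0_def VF_T)

lemma OF1_d0: assumes "f \<in> R" shows "OF1 (d0 A f)"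
  using assms by (auto simp: one_form_def app1_d0 VF_R)
    (auto simp: cotangent_space_def d0_def T_closed_add T_closed_scl)

section \<open>Local frames and tensoriality\<close>

text \<open>
  The link between the algebraic tangent vectors and coordinates. The functions \<open>\<psi>\<close> and \<open>x i\<close> are the
  constant \<open>1\<close> and the coordinates of a chart, both multiplied by a bump function \<open>b\<close>, and \<open>D i\<close> is
  \<open>b \<partial>\<^sub>i\<close>; all are defined on the whole manifold. Where \<open>b \<noteq> 0\<close>, Hadamard's lemma at the image \<open>z\<close>
  of \<open>q\<close> gives the global identity
  \<open>\<psi>\<^sup>2 (f - f(q)) = (\<Sum>i. b g\<^sub>i (x\<^sub>i - z\<^sub>i \<psi>))\<close>, in which the factors \<open>x\<^sub>i - z\<^sub>i \<psi>\<close> vanish at \<open>q\<close>; applying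
  the derivation \<open>v\<close> at \<open>q\<close> leaves \<open>\<psi>\<^sup>2 v f = (\<Sum>i. D\<^sub>i f (v x\<^sub>i - z\<^sub>i v \<psi>))\<close>. The third factor \<open>\<psi>\<close> turns
  \<open>z\<^sub>i \<psi>(q)\<close> into \<open>x\<^sub>i(q)\<close>, so that the coefficients depend smoothly on \<open>q\<close> when \<open>v\<close> is the value of a
  vector field.
\<close>

lemma local_frame:
  obtains \<psi> :: "'a \<Rightarrow> real" and x :: "'e \<Rightarrow> 'a \<Rightarrow> real" and D :: "'e \<Rightarrow> 'a \<Rightarrow> 'a tvec"
  where "\<psi> \<in> R" "\<psi> p \<noteq> 0" "\<And>i. x i \<in> R" "\<And>i. VF (D i)"
    "\<And>q v f. v \<in> T q \<Longrightarrow> f \<in> R \<Longrightarrow>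
      \<psi> q ^ 3 * v f = (\<Sum>i\<in>Basis. (\<psi> q * v (x i) - x i q * v \<psi>) * D i q f)"
proof -
  obtain U c where Uc: "(U, c) \<in> A" "p \<in> U" by (rule chart_cover)
  note U = chartD[OF Uc(1)]
  obtain \<rho> where \<rho>: "\<rho> > 0" "cball (c p) \<rho> \<subseteq> c ` U"
    using U(2) Uc(2) open_contains_cball by blast
  obtain b :: "'e \<Rightarrow> real" where b: "smooth_on UNIV b" "b (c p) \<noteq> 0"
    "\<And>y. y \<notin> cball (c p) (\<rho> / 2) \<Longrightarrow> b y = 0"
    using bump_exists[of "\<rho> / 2" "c p"] \<rho>(1) by auto
  define S where "S = ball (c p) \<rho>"
  have S: "open S" "convex S" "S \<subseteq> c ` U" "c p \<in> S" using \<rho> by (auto simp: S_def)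
  define W where "W = inv_into U c ` S"
  have W: "q \<in> W \<longleftrightarrow> q \<in> U \<and> c q \<in> S" for q
  proof
    assume "q \<in> W"
    then obtain y where "y \<in> S" "q = inv_into U c y" by (auto simp: W_def)
    then show "q \<in> U \<and> c q \<in> S" using S(3) by (simp add: inv_into_into f_inv_into_f subset_iff)
  next
    assume "q \<in> U \<and> c q \<in> S"
    then show "q \<in> W" unfolding W_def using U(5) by (intro image_eqI[of _ _ "c q"]) simp_all
  qed
  have inv_c: "inv_into U c (c q) = q" if "q \<in> W" for q
    using that U(5) by (simp add: W inv_into_f_f)
  have openW: "open W"
  proof -
    have "W = U \<inter> c -` S" using W by auto
    then show ?thesis using continuous_open_preimage[OF U(3,1) S(1)] by simp
  qed
  \<comment> \<open>The support of the cut-off is closed because compact sets of a Hausdorff space are.\<close>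
  define K where "K = inv_into U c ` cball (c p) (\<rho> / 2)"
  have "compact K"
    unfolding K_def using \<rho>
    by (intro compact_continuous_image continuous_on_subset[OF U(4)]) (auto simp: subset_iff)
  then have closedK: "closed K" by (rule compact_imp_closed)
  have K: "q \<in> K" if "q \<in> U" "b (c q) \<noteq> 0" for q
    unfolding K_def using b(3)[of "c q"] that U(5) by (intro image_eqI[of _ _ "c q"]) auto
  have "K \<subseteq> W" unfolding K_def W_def S_def using \<rho>(1) by (intro image_mono) auto
  \<comment> \<open>Functions on the coordinate ball, cut off and transported to the manifold.\<close>
  define lift where "lift = (\<lambda>h q. if q \<in> W then b (c q) * h (c q) else 0)"
  have lift_R: "lift h \<in> R" if h: "smooth_on S h" for h :: "'e \<Rightarrow> real"
    unfolding R_iff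
  proof (clarify)
    fix V d assume Vd: "(V, d) \<in> A"
    note V = chartD[OF Vd]
    \<comment> \<open>In any other chart, the lift is a composition with a transition map over \<open>W\<close> and zero off \<open>K\<close>.\<close>
    have op: "open (d ` (V \<inter> W))" "open (d ` (V \<inter> - K))"
      using chart_image_open[OF Vd] openW closedK by auto
    have inv_d: "inv_into V d (d q) = q" if "q \<in> V" for q using V(5) that by simp
    have "d ` V = d ` (V \<inter> W) \<union> d ` (V \<inter> - K)" using \<open>K \<subseteq> W\<close> by blast
    moreover have "smooth_on (d ` (V \<inter> W)) (\<lambda>y. lift h (inv_into V d y))"
    proof -
      have tr: "smooth_on (d ` (V \<inter> W)) (\<lambda>y. c (inv_into V d y))"
        by (rule smooth_on_subset[OF transition_smooth[OF Vd Uc(1), unfolded o_def]]) (auto simp: W)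
      have bh: "smooth_on S (\<lambda>y. b y * h y)"
        by (rule smooth_on_mult[OF S(1) smooth_on_subset[OF b(1)] h]) simp
      have "smooth_on (d ` (V \<inter> W)) (\<lambda>y. b (c (inv_into V d y)) * h (c (inv_into V d y)))"
      proof (rule smooth_on_compose[OF op(1) S(1) _ bh tr])
        show "(\<lambda>y. c (inv_into V d y)) ` d ` (V \<inter> W) \<subseteq> S"
          unfolding image_image by (intro image_subsetI) (simp add: inv_d W)
      qed
      then show ?thesis
        by (rule smooth_on_cong[OF _ op(1)]) (elim imageE, simp add: lift_def inv_d)
    qed
    moreover have "smooth_on (d ` (V \<inter> - K)) (\<lambda>y. lift h (inv_into V d y))"
      by (rule smooth_on_cong[OF smooth_on_const[OF op(2), of 0] op(2)])
        (elim imageE, use K W in \<open>auto simp: lift_def inv_d\<close>)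
    ultimately show "smooth_on (d ` V) (\<lambda>y. lift h (inv_into V d y))"
      using smooth_on_Un[OF op] by metis
  qed
  define loc where "loc = (\<lambda>(f :: 'a \<Rightarrow> real) y. f (inv_into U c y))"
  have loc: "smooth_on S (loc f)" if "f \<in> R" for f :: "'a \<Rightarrow> real"
    using R_chart[OF that Uc(1)] S(3) unfolding loc_def by (rule smooth_on_subset)
  have loc_c: "loc f (c q) = f q" if "q \<in> W" for f :: "'a \<Rightarrow> real" and q
    by (simp add: loc_def inv_c[OF that])
  have cS: "c q \<in> S" if "q \<in> W" for q using that W by simp
  define D where "D = (\<lambda>i q f. if f \<in> R then lift (\<lambda>y. frechet_derivative (loc f) (at y) i) q else 0)"
  have DT: "D i q \<in> T q" for i q
  proof (cases "q \<in> W")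
    case False
    then have "D i q = 0" by (auto simp: D_def lift_def)
    then show ?thesis by (simp add: T_closed_zero)
  next
    case True
    have der: "(loc f has_derivative frechet_derivative (loc f) (at (c q))) (at (c q))" if "f \<in> R" for f
      using smooth_onD[OF loc[OF that] cS[OF True]] .
    have Dq: "D i q f = b (c q) * frechet_derivative (loc f) (at (c q)) i" if "f \<in> R" for f
      using that True by (simp add: D_def lift_def)
    have add: "frechet_derivative (loc (f + g)) (at (c q)) = (\<lambda>v. frechet_derivative (loc f) (at (c q)) v
        + frechet_derivative (loc g) (at (c q)) v)" if "f \<in> R" "g \<in> R" for f g
    proof (rule frechet_derivative_at[symmetric])
      have "loc (f + g) = (\<lambda>y. loc f y + loc g y)" by (simp add: loc_def)
      then show "(loc (f + g) has_derivative (\<lambda>v. frechet_derivative (loc f) (at (c q)) v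
        + frechet_derivative (loc g) (at (c q)) v)) (at (c q))"
        using has_derivative_add[OF der[OF that(1)] der[OF that(2)]] by simp
    qed
    have mult: "frechet_derivative (loc (f * g)) (at (c q)) = (\<lambda>v. f q * frechet_derivative (loc g) (at (c q)) v
        + frechet_derivative (loc f) (at (c q)) v * g q)" if "f \<in> R" "g \<in> R" for f g
    proof (rule frechet_derivative_at[symmetric])
      have "loc (f * g) = (\<lambda>y. loc f y * loc g y)" by (simp add: loc_def)
      then show "(loc (f * g) has_derivative (\<lambda>v. f q * frechet_derivative (loc g) (at (c q)) v
        + frechet_derivative (loc f) (at (c q)) v * g q)) (at (c q))"
        using has_derivative_mult[OF der[OF that(1)] der[OF that(2)]] loc_c[OF True] by simp
    qed
    have const: "frechet_derivative (loc (\<lambda>_. r)) (at (c q)) = (\<lambda>v. 0)" for r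
      by (simp add: loc_def)
    show ?thesis
    proof (rule TI)
      show "D i q f = 0" if "f \<notin> R" for f using that by (simp add: D_def)
    qed (simp_all add: Dq R_add R_mult R_const add mult const distrib_left distrib_right mult.commute mult.left_commute)
  qed
  have D_VF: "VF (D i)" for i
  proof -
    have "ract (D i) f = lift (\<lambda>y. frechet_derivative (loc f) (at y) i)" if "f \<in> R" for f
      using that by (simp add: fun_eq_iff D_def)
    then show ?thesis
      by (simp add: vector_field_def DT lift_R smooth_on_derivative loc)
  qed
  define \<psi> where "\<psi> = lift (\<lambda>_. 1)"
  define x where "x = (\<lambda>i. lift (\<lambda>y. y \<bullet> i))"
  have \<psi>_R: "\<psi> \<in> R" unfolding \<psi>_def by (rule lift_R[OF smooth_on_const[OF S(1)]])
  have x_R: "x i \<in> R" for i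
    unfolding x_def by (rule lift_R[OF smooth_on_linear[OF S(1) bounded_linear_inner_left]])
  have expand: "\<psi> q ^ 3 * v f = (\<Sum>i\<in>Basis. (\<psi> q * v (x i) - x i q * v \<psi>) * D i q f)"
    if v: "v \<in> T q" and f: "f \<in> R" for q v f
  proof (cases "\<psi> q = 0")
    case True
    then have "x i q = 0" for i by (auto simp: \<psi>_def x_def lift_def)
    with True show ?thesis by simp
  next
    case False
    then have qW: "q \<in> W" by (auto simp: \<psi>_def lift_def split: if_splits)
    obtain g where g: "\<And>i. smooth_on S (g i)" "\<And>i. g i (c q) = frechet_derivative (loc f) (at (c q)) i"
      "\<And>y. y \<in> S \<Longrightarrow> loc f y = loc f (c q) + (\<Sum>i\<in>Basis. ((y - c q) \<bullet> i) * g i y)"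
      by (rule hadamard[OF S(2,1) cS[OF qW] loc[OF f]]) (rule that)
    define z where "z = (\<lambda>i. c q \<bullet> i)"
    have xq: "x i q = z i * \<psi> q" for i using qW by (simp add: x_def \<psi>_def lift_def z_def)
    have gR: "lift (g i) \<in> R" for i using lift_R[OF g(1)] .
    have gq: "lift (g i) q = D i q f" for i using qW f g(2) by (simp add: D_def lift_def)
    have id: "\<psi> * \<psi> * (f - (\<lambda>_. f q)) = (\<Sum>i\<in>Basis. lift (g i) * (x i - (\<lambda>_. z i) * \<psi>))"
    proof
      fix q'
      show "(\<psi> * \<psi> * (f - (\<lambda>_. f q))) q' = (\<Sum>i\<in>Basis. lift (g i) * (x i - (\<lambda>_. z i) * \<psi>)) q'"
      proof (cases "q' \<in> W")
        case False
        then show ?thesis by (simp add: sum_fun_apply \<psi>_def lift_def)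
      next
        case True
        have "f q' - f q = (\<Sum>i\<in>Basis. ((c q' - c q) \<bullet> i) * g i (c q'))"
          using g(3)[OF cS[OF True]] loc_c[OF True] loc_c[OF qW] by simp
        then show ?thesis
          using True by (simp add: sum_fun_apply \<psi>_def x_def z_def lift_def inner_diff_left sum_distrib_left algebra_simps)
      qed
    qed
    have "v (\<psi> * \<psi> * (f - (\<lambda>_. f q))) = \<psi> q * \<psi> q * v f"
      using v f by (simp add: T_mult T_diff T_const R_intros \<psi>_R)
    moreover have "v (\<Sum>i\<in>Basis. lift (g i) * (x i - (\<lambda>_. z i) * \<psi>)) = (\<Sum>i\<in>Basis. D i q f * (v (x i) - z i * v \<psi>))"
      using v by (subst T_sum) (auto intro!: sum.cong simp: T_mult T_diff T_const R_intros \<psi>_R gR x_R xq gq)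
    ultimately have "\<psi> q * \<psi> q * v f = (\<Sum>i\<in>Basis. D i q f * (v (x i) - z i * v \<psi>))"
      unfolding id by simp
    then have "\<psi> q ^ 3 * v f = \<psi> q * (\<Sum>i\<in>Basis. D i q f * (v (x i) - z i * v \<psi>))"
      by (simp add: power3_eq_cube)
    also have "\<dots> = (\<Sum>i\<in>Basis. (\<psi> q * v (x i) - x i q * v \<psi>) * D i q f)"
      by (simp add: sum_distrib_left xq algebra_simps)
    finally show ?thesis .
  qed
  have "\<psi> p \<noteq> 0" using b(2) Uc(2) S(4) by (simp add: \<psi>_def lift_def W)
  from that[OF \<psi>_R this x_R D_VF expand] show thesis .
qed

text \<open>
  Take the combination of the \<open>D i\<close> with the values of the coefficients at \<open>p\<close> as constants.
\<close>

lemma T_extend: assumes "v \<in> T p" obtains X where "VF X" "X p = v"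
proof -
  obtain \<psi> x D where F: "\<psi> \<in> R" "\<psi> p \<noteq> 0" "\<And>i::'e. x i \<in> R" "\<And>i. VF (D i)"
    "\<And>q v f. v \<in> T q \<Longrightarrow> f \<in> R \<Longrightarrow>
      \<psi> q ^ 3 * v f = (\<Sum>i\<in>Basis. (\<psi> q * v (x i) - x i q * v \<psi>) * D i q f)"
    by (rule local_frame[of p]) (rule that)
  let ?X = "\<Sum>i\<in>Basis. fscl (\<lambda>_. (\<psi> p * v (x i) - x i p * v \<psi>) / \<psi> p ^ 3) (D i)"
  have X: "VF ?X" by (intro VF_sum VF_fscl R_const F finite_Basis)
  moreover have "?X p = v"
  proof (rule T_eqI[OF VF_T[OF X] assms])
    fix f assume f: "f \<in> R"
    have "\<psi> p ^ 3 * ?X p f = (\<Sum>i\<in>Basis. (\<psi> p * v (x i) - x i p * v \<psi>) * D i p f)"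
      using F(2) by (simp add: sum_fun_apply sum_distrib_left)
    also have "\<dots> = \<psi> p ^ 3 * v f" using F(5)[OF assms f] by simp
    finally show "?X p f = v f" using F(2) by (simp only: mult_cancel_left power_eq_0_iff) simp
  qed
  ultimately show thesis by (rule that)
qed

text \<open>
  If \<open>X\<close> vanishes at \<open>p\<close>, then \<open>\<psi>\<^sup>3 X\<close> is the combination of the \<open>D i\<close> with coefficients
  \<open>\<psi> X(x\<^sub>i) - x\<^sub>i X(\<psi>)\<close>, smooth functions that vanish at \<open>p\<close>. Hence function-linear operations on
  vector fields are pointwise.
\<close>

lemma tensorial_zero:
  assumes add: "\<And>X Y. VF X \<Longrightarrow> VF Y \<Longrightarrow> \<Phi> (X + Y) = \<Phi> X + (\<Phi> Y :: real)"
    and scale: "\<And>h X. h \<in> R \<Longrightarrow> VF X \<Longrightarrow> \<Phi> (fscl h X) = h p * \<Phi> X"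
    and X: "VF X" "X p = 0"
  shows "\<Phi> X = 0"
proof -
  obtain \<psi> x D where F: "\<psi> \<in> R" "\<psi> p \<noteq> 0" "\<And>i::'e. x i \<in> R" "\<And>i. VF (D i)"
    "\<And>q v f. v \<in> T q \<Longrightarrow> f \<in> R \<Longrightarrow>
      \<psi> q ^ 3 * v f = (\<Sum>i\<in>Basis. (\<psi> q * v (x i) - x i q * v \<psi>) * D i q f)"
    by (rule local_frame[of p]) (rule that)
  define h where "h = (\<lambda>i. \<psi> * ract X (x i) - x i * ract X \<psi>)"
  have h: "h i \<in> R" "h i p = 0" for i
    using X F by (auto simp: h_def R_intros VF_R)
  have sum: "\<Phi> (sum Y I) = (\<Sum>i\<in>I. \<Phi> (Y i))" if "finite I" "\<And>i. VF (Y i)" for Y and I :: "'e set"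
    using that
  proof (induction I rule: finite_induct)
    case empty
    have "\<Phi> (fscl 0 0) = 0" using scale[OF R_zero VF_zero] by simp
    moreover have "fscl 0 0 = (0 :: 'a \<Rightarrow> 'a tvec)" by (simp add: fun_eq_iff)
    ultimately show ?case by (simp only: sum.empty)
  qed (simp add: add VF_sum)
  have \<psi>3: "\<psi> * \<psi> * \<psi> \<in> R" by (intro R_mult F)
  have "fscl (\<psi> * \<psi> * \<psi>) X = (\<Sum>i\<in>Basis. fscl (h i) (D i))"
  proof (rule VF_eqI)
    show "fscl (\<psi> * \<psi> * \<psi>) X q f = (\<Sum>i\<in>Basis. fscl (h i) (D i)) q f" if "f \<in> R" for q f
      using F(5)[OF VF_T[OF X(1)] that] by (simp add: sum_fun_apply h_def power3_eq_cube)
  qed (intro VF_fscl VF_sum \<psi>3 X h F finite_Basis)+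
  then have "\<psi> p * \<psi> p * \<psi> p * \<Phi> X = \<Phi> (\<Sum>i\<in>Basis. fscl (h i) (D i))"
    using scale[OF \<psi>3 X(1)] by simp
  also have "\<dots> = 0"
    by (subst sum) (simp_all add: VF_fscl h F scale)
  finally show ?thesis using F(2) by simp
qed

section \<open>The exterior derivative of a one-form\<close>

lemma d1_eval_anti: "OF1 \<alpha> \<Longrightarrow> VF X \<Longrightarrow> VF Y \<Longrightarrow> d1_eval \<alpha> Y X = - d1_eval \<alpha> X Y"
  unfolding d1_eval_def lie_anti[of Y X] by (simp add: app1_uminus VF_lie)

lemma ract_add: "VF X \<Longrightarrow> f \<in> R \<Longrightarrow> g \<in> R \<Longrightarrow> ract X (f + g) = ract X f + ract X g"
  and ract_uminus: "VF X \<Longrightarrow> f \<in> R \<Longrightarrow> ract X (- f) = - ract X f"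
  and ract_mult: "VF X \<Longrightarrow> f \<in> R \<Longrightarrow> g \<in> R \<Longrightarrow> ract X (f * g) = f * ract X g + g * ract X f"
  and ract_zero: "VF X \<Longrightarrow> ract X 0 = 0"
  by (simp_all add: fun_eq_iff T_add[OF VF_T] T_uminus[OF VF_T] T_mult[OF VF_T] T_zero_fun[OF VF_T])

lemma d1_eval_add:
  assumes "OF1 \<alpha>" "VF X" "VF X'" "VF Y"
  shows "d1_eval \<alpha> (X + X') Y = d1_eval \<alpha> X Y + d1_eval \<alpha> X' Y"
  using assms
  by (simp add: d1_eval_def app1_add lie_add_left ract_linear ract_add VF_lie OF1_R)

lemma d1_eval_fscl:
  assumes "OF1 \<alpha>" "VF X" "VF Y" "h \<in> R"
  shows "d1_eval \<alpha> (fscl h X) Y = h * d1_eval \<alpha> X Y"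
  using assms
  by (simp add: d1_eval_def app1_fscl app1_diff lie_fscl_left ract_linear ract_mult VF_lie VF_fscl VF_R OF1_R algebra_simps)

lemma d1_eval_cong:
  assumes \<alpha>: "OF1 \<alpha>" and vf: "VF X" "VF X'" "VF Y" "VF Y'" and eq: "X p = X' p" "Y p = Y' p"
  shows "d1_eval \<alpha> X Y p = d1_eval \<alpha> X' Y' p"
proof -
  have left: "d1_eval \<alpha> X Y p = d1_eval \<alpha> X' Y p"
    if "VF X" "VF X'" "VF Y" "X p = X' p" for X X' Y
  proof -
    have "d1_eval \<alpha> (X - X') Y p = 0"
      by (rule tensorial_zero[where \<Phi> = "\<lambda>X. d1_eval \<alpha> X Y p" and p = p])
        (use \<alpha> that in \<open>simp_all add: d1_eval_add d1_eval_fscl VF_diff\<close>)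
    then show ?thesis
      using d1_eval_add[OF \<alpha> VF_diff[OF that(1,2)] that(2,3)] by simp
  qed
  have "d1_eval \<alpha> X Y p = d1_eval \<alpha> X' Y p" using left vf eq by blast
  also have "\<dots> = - d1_eval \<alpha> Y X' p" using d1_eval_anti[OF \<alpha> vf(3,2)] by simp
  also have "\<dots> = - d1_eval \<alpha> Y' X' p" using left vf eq by metis
  also have "\<dots> = d1_eval \<alpha> X' Y' p" using d1_eval_anti[OF \<alpha> vf(2,4)] by simp
  finally show ?thesis .
qed

text \<open>
  By tensoriality, the value of \<open>d\<alpha>\<close> on two tangent vectors at \<open>p\<close> can be computed with arbitrary
  extensions to vector fields.
\<close>

lemma two_form_exists:
  assumes \<alpha>: "OF1 \<alpha>"
  shows "\<exists>\<omega>. two_form A \<omega> \<and> (\<forall>X Y. VF X \<and> VF Y \<longrightarrow> (\<lambda>p. \<omega> p (X p) (Y p)) = d1_eval \<alpha> X Y)"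
proof -
  define E where "E = (\<lambda>p v. SOME X. VF X \<and> X p = v)"
  have E: "VF (E p v)" "E p v p = v" if "v \<in> T p" for p v
  proof -
    have "\<exists>X. VF X \<and> X p = v" by (rule T_extend[OF that]) blast
    then have "VF (E p v) \<and> E p v p = v" unfolding E_def by (rule someI_ex)
    then show "VF (E p v)" "E p v p = v" by blast+
  qed
  define \<omega> where "\<omega> = (\<lambda>p v w. if v \<in> T p \<and> w \<in> T p then d1_eval \<alpha> (E p v) (E p w) p else 0)"
  have \<omega>: "\<omega> p (X p) (Y p) = d1_eval \<alpha> X Y p" if "VF X" "VF Y" for p X Y
    unfolding \<omega>_def using that by (auto intro!: d1_eval_cong \<alpha> E simp: VF_T)
  have anti: "\<omega> p v w = - \<omega> p w v" for p v w
    using d1_eval_anti[OF \<alpha> E(1) E(1), of w p v p] by (simp add: \<omega>_def)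
  have cot: "\<omega> p v \<in> Tstar p" if v: "v \<in> T p" for p v
    unfolding cotangent_space_def
  proof (intro CollectI conjI ballI allI impI)
    fix w w' assume w: "w \<in> T p" "w' \<in> T p"
    have "\<omega> p (w + w') v = \<omega> p w v + \<omega> p w' v"
      using \<omega>[OF VF_add[OF E(1)[OF w(1)] E(1)[OF w(2)]] E(1)[OF v], of p]
        \<omega>[OF E(1)[OF w(1)] E(1)[OF v], of p] \<omega>[OF E(1)[OF w(2)] E(1)[OF v], of p]
      by (simp add: d1_eval_add \<alpha> E v w)
    then show "\<omega> p v (w + w') = \<omega> p v w + \<omega> p v w'"
      using anti[of p v "w + w'"] anti[of p v w] anti[of p v w'] by simp
  next
    fix r w assume w: "w \<in> T p"
    have "\<omega> p (scl r w) v = r * \<omega> p w v"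
      using \<omega>[OF VF_fscl[OF R_const[of r] E(1)[OF w]] E(1)[OF v], of p] \<omega>[OF E(1)[OF w] E(1)[OF v], of p]
      by (simp add: d1_eval_fscl \<alpha> E v w R_const)
    then show "\<omega> p v (scl r w) = r * \<omega> p v w"
      using anti[of p v "scl r w"] anti[of p v w] by simp
  qed (simp add: \<omega>_def)
  have eval: "(\<lambda>p. \<omega> p (X p) (Y p)) = d1_eval \<alpha> X Y" if "VF X" "VF Y" for X Y
    using \<omega>[OF that] by auto
  have smooth: "d1_eval \<alpha> X Y \<in> R" if "VF X" "VF Y" for X Y
    using \<alpha> that by (simp add: d1_eval_def R_diff VF_R OF1_R VF_lie)
  have "\<omega> p v = 0" if "v \<notin> T p" for p v using that by (simp add: \<omega>_def fun_eq_iff)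
  then have "two_form A \<omega>"
    unfolding two_form_def
    by (intro conjI allI ballI impI cot anti) (auto simp only: eval smooth)
  with eval show ?thesis by blast
qed

text \<open>
  Tangent vectors extend to vector fields, so the values on vector fields determine a 2-form; thus
  the definite description in \<open>d1\<close> denotes.
\<close>

lemma d1:
  assumes \<alpha>: "OF1 \<alpha>"
  shows d1_two_form: "two_form A (d1 A \<alpha>)"
    and d1_apply: "\<And>X Y. VF X \<Longrightarrow> VF Y \<Longrightarrow> (\<lambda>p. d1 A \<alpha> p (X p) (Y p)) = d1_eval \<alpha> X Y"
proof -
  let ?P = "\<lambda>\<omega>. two_form A \<omega> \<and> (\<forall>X Y. VF X \<and> VF Y \<longrightarrow> (\<lambda>p. \<omega> p (X p) (Y p)) = d1_eval \<alpha> X Y)"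
  obtain \<omega> where \<omega>: "?P \<omega>" using two_form_exists[OF \<alpha>] by blast
  have "\<omega>' = \<omega>" if \<omega>': "?P \<omega>'" for \<omega>'
  proof (intro ext)
    fix p v w
    show "\<omega>' p v w = \<omega> p v w"
    proof (cases "v \<in> T p \<and> w \<in> T p")
      case True
      then have "v \<in> T p" "w \<in> T p" by auto
      obtain X where "VF X" "X p = v" by (rule T_extend[OF \<open>v \<in> T p\<close>])
      obtain Y where "VF Y" "Y p = w" by (rule T_extend[OF \<open>w \<in> T p\<close>])
      have "(\<lambda>p. \<omega>' p (X p) (Y p)) = (\<lambda>p. \<omega> p (X p) (Y p))"
        using \<omega> \<omega>' \<open>VF X\<close> \<open>VF Y\<close> by simp
      from fun_cong[OF this, of p] show ?thesis using \<open>X p = v\<close> \<open>Y p = w\<close> by simp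
    next
      case False
      have "\<zeta> p v w = 0" if "two_form A \<zeta>" for \<zeta>
      proof (cases "v \<in> T p")
        case True
        then have "\<zeta> p v \<in> Tstar p" using that by (simp add: two_form_def)
        then show ?thesis using True False Tstar_outside by blast
      next
        case False
        then show ?thesis using that by (simp add: two_form_def)
      qed
      from this[of \<omega>] this[of \<omega>'] show ?thesis using \<omega> \<omega>' by simp
    qed
  qed
  then have "?P (d1 A \<alpha>)" unfolding d1_def by (rule theI[of ?P, OF \<omega>])
  then show "two_form A (d1 A \<alpha>)"
    and "\<And>X Y. VF X \<Longrightarrow> VF Y \<Longrightarrow> (\<lambda>p. d1 A \<alpha> p (X p) (Y p)) = d1_eval \<alpha> X Y" by simp_all
qed

lemma OF1_contract:
  assumes "two_form A \<omega>" "VF X" shows "OF1 (\<lambda>p. \<omega> p (X p))"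
  unfolding one_form_def app1_def
proof (intro conjI allI impI)
  show "\<omega> p (X p) \<in> Tstar p" for p
    using assms VF_T[OF assms(2), of p] unfolding two_form_def by blast
  show "(\<lambda>p. \<omega> p (X p) (Y p)) \<in> R" if "VF Y" for Y
    using assms that unfolding two_form_def by simp
qed

end

section \<open>The bracket and the differential on \<open>TM \<times> \<real>\<close>\<close>

definition smul :: "('a \<Rightarrow> real) \<Rightarrow> 'a tr_sec \<Rightarrow> 'a tr_sec" where
  "smul h s = (fscl h (fst s), h * snd s)"

definition tr_bracket :: "'a tr_sec \<Rightarrow> 'a tr_sec \<Rightarrow> 'a tr_sec" where
  "tr_bracket s t = (lie_bracket (fst s) (fst t), ract (fst s) (snd t) - ract (fst t) (snd s))"

text \<open>
  The action of a section \<open>(X, f)\<close> on functions, \<open>h \<mapsto> X \<cdot> h + f h\<close>. The extra term is the contribution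
  of the second component of \<open>d\<close>-tilde.
\<close>

definition twd :: "'a tr_sec \<Rightarrow> ('a \<Rightarrow> real) \<Rightarrow> 'a \<Rightarrow> real" where
  "twd s h = ract (fst s) h + snd s * h"

lemma eq_uminus_self: "z = - z \<Longrightarrow> z = (0 :: 'a tr_sec)"
  by (cases z) (auto simp: fun_eq_iff zero_prod_def)

lemma fscl_0 [simp]: "fscl 0 X = 0" "fscl h 0 = 0" and fscl_1 [simp]: "fscl 1 X = X"
  by (auto simp: fun_eq_iff)

lemma fscl_linear:
  "fscl h (X + Y) = fscl h X + fscl h Y" "fscl h (X - Y) = fscl h X - fscl h Y"
  "fscl h (- X) = - fscl h X" "fscl (g + h) X = fscl g X + fscl h X"
  "fscl (g - h) X = fscl g X - fscl h X" "fscl (- h) X = - fscl h X"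
  "fscl g (fscl h X) = fscl (g * h) X"
  by (simp_all add: fun_eq_iff algebra_simps)

context smooth_mfd
begin

abbreviation "L \<equiv> tr_sections A"
abbreviation "Lstar \<equiv> ctr_sections A"

lemma L_iff: "s \<in> L \<longleftrightarrow> VF (fst s) \<and> snd s \<in> R"
  and Lstar_iff: "w \<in> Lstar \<longleftrightarrow> OF1 (fst w) \<and> snd w \<in> R"
  by (cases s, simp add: tr_sections_def) (cases w, simp add: ctr_sections_def)

lemma L_add: "s \<in> L \<Longrightarrow> t \<in> L \<Longrightarrow> s + t \<in> L"
  and L_diff: "s \<in> L \<Longrightarrow> t \<in> L \<Longrightarrow> s - t \<in> L"
  and L_smul: "h \<in> R \<Longrightarrow> s \<in> L \<Longrightarrow> smul h s \<in> L"
  and L_bracket: "s \<in> L \<Longrightarrow> t \<in> L \<Longrightarrow> tr_bracket s t \<in> L"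
  by (simp_all add: L_iff VF_add VF_diff VF_uminus VF_fscl VF_lie VF_R R_intros smul_def tr_bracket_def)

lemma Lstar_add: "w \<in> Lstar \<Longrightarrow> w' \<in> Lstar \<Longrightarrow> w + w' \<in> Lstar"
  and Lstar_diff: "w \<in> Lstar \<Longrightarrow> w' \<in> Lstar \<Longrightarrow> w - w' \<in> Lstar"
  and Lstar_zero: "0 \<in> Lstar"
  by (simp_all add: Lstar_iff OF1_add OF1_diff OF1_zero R_intros)

lemma tr_bracket_anti: "tr_bracket s t = - tr_bracket t s"
  by (simp add: tr_bracket_def lie_anti[of "fst s" "fst t"])

lemma tr_bracket_add_left:
  "s \<in> L \<Longrightarrow> s' \<in> L \<Longrightarrow> t \<in> L \<Longrightarrow> tr_bracket (s + s') t = tr_bracket s t + tr_bracket s' t"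
  by (simp add: L_iff tr_bracket_def lie_add_left ract_linear ract_add)

lemma tr_bracket_smul_left:
  assumes "s \<in> L" "t \<in> L" "h \<in> R"
  shows "tr_bracket (smul h s) t = smul h (tr_bracket s t) - smul (ract (fst t) h) s"
  using assms
  by (simp add: L_iff tr_bracket_def smul_def lie_fscl_left ract_linear ract_mult algebra_simps)

lemma smul_minus_one: "smul (- 1) s = - s"
  by (cases s) (simp add: smul_def fun_eq_iff)

lemma ract_const: "VF X \<Longrightarrow> ract X (- 1) = 0"
  using ract_uminus[OF _ R_one] by (auto simp: fun_eq_iff T_one[OF VF_T])

lemma smul_0 [simp]: "smul 0 s = 0"
  by (simp add: smul_def zero_prod_def)

lemma tr_bracket_uminus_left: "s \<in> L \<Longrightarrow> t \<in> L \<Longrightarrow> tr_bracket (- s) t = - tr_bracket s t"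
  using tr_bracket_smul_left[of s t "- 1"]
  by (simp add: smul_minus_one R_uminus R_one ract_const L_iff)

lemma it1_alt: "it1 s w = app1 (fst w) (fst s) + snd s * snd w"
  by (simp add: it1_def split_beta)

lemma it1_R: "s \<in> L \<Longrightarrow> w \<in> Lstar \<Longrightarrow> it1 s w \<in> R"
  by (simp add: it1_alt L_iff Lstar_iff OF1_R R_intros)

lemma it1_add: "w \<in> Lstar \<Longrightarrow> s \<in> L \<Longrightarrow> t \<in> L \<Longrightarrow> it1 (s + t) w = it1 s w + it1 t w"
  and it1_uminus: "w \<in> Lstar \<Longrightarrow> s \<in> L \<Longrightarrow> it1 (- s) w = - it1 s w"
  by (simp_all add: it1_alt L_iff Lstar_iff app1_add app1_uminus algebra_simps)

lemma it1_add_right: "it1 s (w + w') = it1 s w + it1 s w'"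
  and it1_diff_right: "it1 s (w - w') = it1 s w - it1 s w'"
  and it1_zero_right: "it1 s 0 = 0"
  by (simp_all add: it1_alt app1_linear algebra_simps) (simp add: fun_eq_iff)

lemma twd_uminus: "s \<in> L \<Longrightarrow> h \<in> R \<Longrightarrow> twd s (- h) = - twd s h"
  by (simp add: twd_def L_iff ract_uminus)

lemma it1_dt0: "s \<in> L \<Longrightarrow> it1 s (dt0 A h) = twd s h"
  by (simp add: it1_alt dt0_def twd_def app1_d0 L_iff)

text \<open>
  The Cartan formula for \<open>d\<close>-tilde on one-forms: the summand \<open>- \<alpha>\<close> of its second component and the term
  \<open>- f \<beta>\<close> of the contraction supply exactly the multiplication terms by which \<open>twd\<close> differs from the
  derivative along a vector field.
\<close>

lemma it1_dt1:
  assumes "s \<in> L" "t \<in> L" "w \<in> Lstar"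
  shows "it1 t (it2 s (dt1 A w)) = twd s (it1 t w) - twd t (it1 s w) - it1 (tr_bracket s t) w"
proof -
  obtain X f Y g \<alpha> k where [simp]: "s = (X, f)" "t = (Y, g)" "w = (\<alpha>, k)"
    by (cases s, cases t, cases w)
  have *: "VF X" "VF Y" "OF1 \<alpha>" "f \<in> R" "g \<in> R" "k \<in> R" using assms by (auto simp: L_iff Lstar_iff)
  have "app1 (\<lambda>p. d1 A \<alpha> p (X p)) Y = d1_eval \<alpha> X Y"
    using d1_apply[OF *(3,1,2)] by (simp add: app1_def)
  then show ?thesis
    using * by (simp add: it1_alt it2_def dt1_def twd_def tr_bracket_def app1_linear app1_d0 d1_eval_def
      ract_add ract_mult OF1_R R_mult algebra_simps)
qed

lemma it2_dt1_Lstar: assumes "s \<in> L" "w \<in> Lstar" shows "it2 s (dt1 A w) \<in> Lstar"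
proof -
  obtain X f \<alpha> k where [simp]: "s = (X, f)" "w = (\<alpha>, k)" by (cases s, cases w)
  have *: "VF X" "OF1 \<alpha>" "f \<in> R" "k \<in> R" using assms by (auto simp: L_iff Lstar_iff)
  have "OF1 (\<lambda>p. d1 A \<alpha> p (X p))" by (rule OF1_contract[OF d1_two_form[OF *(2)] *(1)])
  moreover have "OF1 (- \<alpha> + d0 A k)" using * by (intro OF1_add OF1_uminus OF1_d0)
  ultimately show ?thesis
    using * OF1_diff[OF _ OF1_fscl] by (simp add: it2_def dt1_def Lstar_iff OF1_R)
qed

lemma courant_fst: "fst (courant A \<sigma> \<tau>) = tr_bracket (fst \<sigma>) (fst \<tau>)"
  and courant_snd: "snd (courant A \<sigma> \<tau>) = it2 (fst \<sigma>) (dt1 A (snd \<tau>)) + dt0 A (it1 (fst \<sigma>) (snd \<tau>))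
    - it2 (fst \<tau>) (dt1 A (snd \<sigma>))"
  by (simp_all add: courant_def split_beta tr_bracket_def lie_tilde_def)

lemma e1_sections_iff: "\<sigma> \<in> e1_sections A \<longleftrightarrow> fst \<sigma> \<in> L \<and> snd \<sigma> \<in> Lstar"
  by (cases \<sigma>) (simp add: e1_sections_def)

lemma courant_sections:
  assumes "\<sigma> \<in> e1_sections A" "\<tau> \<in> e1_sections A" shows "courant A \<sigma> \<tau> \<in> e1_sections A"
proof -
  have "dt0 A h \<in> Lstar" if "h \<in> R" for h using that by (simp add: dt0_def Lstar_iff OF1_d0)
  then show ?thesis
    using assms by (simp add: e1_sections_iff courant_fst courant_snd L_bracket Lstar_add Lstar_diff
        it2_dt1_Lstar it1_R)
qed

text \<open>
  The terms with \<open>x\<close> acting on a pairing appear twice with \<open>snd \<tau>\<close>, with opposite signs, and cancel.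
\<close>

lemma it1_courant:
  assumes "\<sigma> \<in> e1_sections A" "\<tau> \<in> e1_sections A" "x \<in> L"
  shows "it1 x (snd (courant A \<sigma> \<tau>)) =
    twd (fst \<sigma>) (it1 x (snd \<tau>)) - it1 (tr_bracket (fst \<sigma>) x) (snd \<tau>)
    - twd (fst \<tau>) (it1 x (snd \<sigma>)) + twd x (it1 (fst \<tau>) (snd \<sigma>)) + it1 (tr_bracket (fst \<tau>) x) (snd \<sigma>)"
  using assms
  by (simp add: e1_sections_iff courant_snd it1_add_right it1_diff_right it1_dt0 it1_dt1)

end

section \<open>Almost contact structures\<close>

locale almost_contact_mfd = smooth_mfd A
  for A :: "('a::{t2_space, second_countable_topology}, 'e::euclidean_space) chart set" +
  fixes \<phi> :: "'a \<Rightarrow> 'a tvec \<Rightarrow> 'a tvec" and \<xi> :: "'a \<Rightarrow> 'a tvec" and \<eta> :: "'a \<Rightarrow> 'a covec"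
  assumes almost_contact: "almost_contact A \<phi> \<xi> \<eta>"
begin

abbreviation "phi \<equiv> app11 \<phi>"
abbreviation "eta \<equiv> app1 \<eta>"

lemma phi_VF: "VF X \<Longrightarrow> VF (phi X)"
  and phi_add: "VF X \<Longrightarrow> VF Y \<Longrightarrow> phi (X + Y) = phi X + phi Y"
  and phi_fscl: "VF X \<Longrightarrow> phi (fscl h X) = fscl h (phi X)"
  using almost_contact by (simp_all add: almost_contact_def tensor11_def fun_eq_iff VF_T)

lemma xi_VF: "VF \<xi>" and eta_OF1: "OF1 \<eta>" and eta_xi: "eta \<xi> = 1"
  and phi_phi: "VF X \<Longrightarrow> phi (phi X) = - X + fscl (eta X) \<xi>"
  using almost_contact by (simp_all add: almost_contact_def one_fun_def)

lemma eta_R: "VF X \<Longrightarrow> eta X \<in> R"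
  by (rule OF1_R[OF eta_OF1])

lemma phi_uminus: "VF X \<Longrightarrow> phi (- X) = - phi X"
  using phi_fscl[of X "- 1"] by (simp add: fscl_linear)

lemma phi_diff: "VF X \<Longrightarrow> VF Y \<Longrightarrow> phi (X - Y) = phi X - phi Y"
  using phi_add[OF _ VF_uminus, of X Y] by (simp add: phi_uminus)

lemma fscl_xi_eq: assumes "fscl g \<xi> = fscl h \<xi>" shows "g = h"
proof -
  have "eta (fscl k \<xi>) = k" for k by (simp add: app1_fscl[OF eta_OF1 xi_VF] eta_xi)
  with assms show ?thesis by metis
qed

text \<open>
  \<open>\<phi>\<^sup>2 \<xi> = 0\<close>, hence also \<open>\<phi>\<^sup>2 (\<phi> \<xi>) = 0\<close>, which says \<open>\<phi> \<xi> = k \<xi>\<close> with \<open>k = \<eta>(\<phi> \<xi>)\<close>. Then \<open>0 = \<phi>\<^sup>2 \<xi> = k\<^sup>2 \<xi>\<close>.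
\<close>

lemma phi_xi: "phi \<xi> = 0"
proof -
  have 0: "phi (phi \<xi>) = 0" using phi_phi[OF xi_VF] by (simp add: eta_xi)
  have "phi 0 = 0" using phi_fscl[OF VF_zero, of 0] by simp
  then have "- phi \<xi> + fscl (eta (phi \<xi>)) \<xi> = 0"
    using phi_phi[OF phi_VF[OF xi_VF]] by (simp only: 0)
  then have "phi \<xi> = fscl (eta (phi \<xi>)) \<xi>" by (simp only: neg_eq_iff_add_eq_0[symmetric] minus_minus)
  then obtain k where k: "phi \<xi> = fscl k \<xi>" ..
  have "fscl (k * k) \<xi> = fscl k (phi \<xi>)" by (simp add: k fscl_linear)
  also have "\<dots> = phi (phi \<xi>)" by (simp add: k phi_fscl xi_VF fscl_linear)
  also have "\<dots> = fscl 0 \<xi>" using 0 by simp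
  finally have "k * k = 0" by (rule fscl_xi_eq)
  then have "k = 0" by (simp add: fun_eq_iff)
  with k show ?thesis by simp
qed

text \<open>
  Compare the two ways to evaluate \<open>\<phi>\<^sup>3 X\<close>: as \<open>\<phi>\<^sup>2\<close> of \<open>\<phi> X\<close>, and as \<open>\<phi>\<close> of \<open>\<phi>\<^sup>2 X\<close>.
\<close>

lemma eta_phi: assumes "VF X" shows "eta (phi X) = 0"
proof -
  have "- phi X + fscl (eta (phi X)) \<xi> = phi (phi (phi X))"
    using phi_phi[OF phi_VF[OF assms]] by simp
  also have "\<dots> = phi (- X + fscl (eta X) \<xi>)" by (simp only: phi_phi[OF assms])
  also have "\<dots> = - phi X" using assms
    by (simp add: phi_diff VF_fscl eta_R xi_VF phi_fscl phi_xi)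
  finally have "fscl (eta (phi X)) \<xi> = fscl 0 \<xi>" by simp
  then show ?thesis by (rule fscl_xi_eq)
qed

section \<open>The complex structure \<open>J\<close> and its Nijenhuis tensor\<close>

definition J :: "'a tr_sec \<Rightarrow> 'a tr_sec" where
  "J s = (phi (fst s) - fscl (snd s) \<xi>, eta (fst s))"

lemma J_L: "s \<in> L \<Longrightarrow> J s \<in> L"
  by (simp add: J_def L_iff VF_diff VF_fscl phi_VF xi_VF eta_R)

lemma J_add: "s \<in> L \<Longrightarrow> t \<in> L \<Longrightarrow> J (s + t) = J s + J t"
  and J_uminus: "s \<in> L \<Longrightarrow> J (- s) = - J s"
  and J_diff: "s \<in> L \<Longrightarrow> t \<in> L \<Longrightarrow> J (s - t) = J s - J t"
  and J_smul: "s \<in> L \<Longrightarrow> J (smul h s) = smul h (J s)"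
  by (simp_all add: J_def L_iff smul_def phi_add phi_uminus phi_diff phi_fscl fscl_linear
      app1_add app1_uminus app1_diff app1_fscl eta_OF1)

lemma J_J: "s \<in> L \<Longrightarrow> J (J s) = - s"
  by (cases s) (simp add: J_def L_iff phi_diff phi_VF VF_fscl xi_VF phi_phi phi_fscl phi_xi
      app1_diff app1_fscl eta_OF1 eta_phi eta_xi)

text \<open>
  The usual Nijenhuis tensor \<open>[Js, Jt] + J\<^sup>2[s, t] - J[Js, t] - J[s, Jt]\<close>, with \<open>J\<^sup>2 = - 1\<close> inserted.
\<close>

definition N :: "'a tr_sec \<Rightarrow> 'a tr_sec \<Rightarrow> 'a tr_sec" where
  "N s t = tr_bracket (J s) (J t) - tr_bracket s t - J (tr_bracket (J s) t) - J (tr_bracket s (J t))"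

lemma N_anti: assumes "s \<in> L" "t \<in> L" shows "N s t = - N t s"
  using assms
  unfolding N_def tr_bracket_anti[of s t] tr_bracket_anti[of s "J t"] tr_bracket_anti[of "J s" t]
    tr_bracket_anti[of "J s" "J t"]
  by (simp add: J_uminus L_bracket J_L)

lemma N_add_left:
  "s \<in> L \<Longrightarrow> s' \<in> L \<Longrightarrow> t \<in> L \<Longrightarrow> N (s + s') t = N s t + N s' t"
  by (simp add: N_def J_add J_L L_bracket tr_bracket_add_left)

lemma N_J_left:
  "s \<in> L \<Longrightarrow> t \<in> L \<Longrightarrow> N (J s) t = - J (N s t)"
  by (simp add: N_def J_J J_L L_bracket L_diff J_diff J_uminus tr_bracket_uminus_left)

text \<open>
  The four derivative terms produced by the Leibniz rule cancel in pairs since \<open>J\<^sup>2 = - 1\<close>.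
\<close>

lemma N_smul_left:
  assumes "s \<in> L" "t \<in> L" "h \<in> R"
  shows "N (smul h s) t = smul h (N s t)"
proof -
  have smul_diff: "smul g (x - y) = smul g x - smul g y" for g :: "'a \<Rightarrow> real" and x y
    by (simp add: smul_def fscl_linear algebra_simps)
  have smul_neg: "smul g (- x) = - smul g x" for g :: "'a \<Rightarrow> real" and x
    by (simp add: smul_def fscl_linear)
  have R: "ract (fst t) h \<in> R" "ract (fst (J t)) h \<in> R"
    using assms J_L[OF assms(2)] by (simp_all add: L_iff VF_R)
  show ?thesis
    using assms R
    by (simp add: N_def J_smul tr_bracket_smul_left J_L L_bracket L_smul J_diff J_J smul_diff smul_neg)
qed

text \<open>
  Here \<open>\<phi>\<^sup>2 [X, Y] = - [X, Y] + \<eta>([X, Y]) \<xi>\<close>, and \<open>\<eta>([X, Y])\<close> completes \<open>d\<eta>(X, Y)\<close> to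
  \<open>X \<cdot> \<eta>(Y) - Y \<cdot> \<eta>(X)\<close>, which is what the second components contribute to the last two terms of \<open>N\<close>.
\<close>

lemma N_fst:
  assumes "VF X" "VF Y"
  shows "fst (N (X, 0) (Y, 0)) = nijenhuis \<phi> X Y + fscl (d1_eval \<eta> X Y) \<xi>"
  using assms
  by (simp add: N_def J_def tr_bracket_def nijenhuis_def d1_eval_def phi_phi VF_lie ract_zero phi_VF
      fscl_linear)

text \<open>
  Normality says that the vector field component of \<open>N\<close> vanishes on pairs \<open>(X, 0)\<close>, \<open>(Y, 0)\<close>. It has to
  be shown that it forces the function component \<open>N2 X Y\<close> and the values on \<open>e = (0, 1)\<close> to vanish as
  well. Apply \<open>N (J s) t = - J (N s t)\<close> to \<open>s = (X, 0)\<close>, where \<open>J s = (\<phi> X, 0) + \<eta>(X) e\<close>. For \<open>X = \<xi>\<close>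
  this expresses \<open>N e (Y, 0)\<close> by \<open>N2 \<xi> Y\<close>; the vector field component for general \<open>X\<close> then reads
  \<open>N2 X Y = \<eta>(X) N2 \<xi> Y\<close>. By antisymmetry, \<open>N2 X Y\<close> is a multiple of \<open>N2 \<xi> \<xi> = 0\<close>.
\<close>

lemma normal_iff: "normal_almost_contact A \<phi> \<xi> \<eta> \<longleftrightarrow> (\<forall>s\<in>L. \<forall>t\<in>L. N s t = 0)"
proof
  assume N: "\<forall>s\<in>L. \<forall>t\<in>L. N s t = 0"
  show "normal_almost_contact A \<phi> \<xi> \<eta>"
    unfolding normal_almost_contact_def
  proof (intro allI impI)
    fix X Y assume XY: "VF X \<and> VF Y"
    then have "(X, 0) \<in> L" "(Y, 0) \<in> L" by (simp_all add: L_iff R_zero)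
    with N have "N (X, 0) (Y, 0) = 0" by blast
    then show "nijenhuis \<phi> X Y + fscl (d1_eval \<eta> X Y) \<xi> = 0"
      using N_fst[of X Y] XY by simp
  qed
next
  assume normal: "normal_almost_contact A \<phi> \<xi> \<eta>"
  define N2 where "N2 = (\<lambda>X Y. snd (N (X, 0) (Y, 0)))"
  define e :: "'a tr_sec" where "e = (0, 1)"
  have e: "e \<in> L" by (simp add: e_def L_iff VF_zero R_one)
  have L0: "(X, 0) \<in> L" if "VF X" for X using that by (simp add: L_iff R_zero)
  have N0: "N (X, 0) (Y, 0) = (0, N2 X Y)" if "VF X" "VF Y" for X Y
    using normal that N_fst[OF that] by (simp add: normal_almost_contact_def N2_def prod_eq_iff)
  have J0: "J (X, 0) = (phi X, 0) + smul (eta X) e" for X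
    by (simp add: J_def smul_def e_def)
  have N0J: "(fscl (N2 X Y) \<xi>, 0) = (0, N2 (phi X) Y) + smul (eta X) (N e (Y, 0))"
    if "VF X" "VF Y" for X Y
  proof -
    have "(fscl (N2 X Y) \<xi>, 0) = - J (0, N2 X Y)"
      using phi_fscl[OF VF_zero, of 0] app1_fscl[OF eta_OF1 VF_zero, of 0] by (simp add: J_def)
    also have "\<dots> = N (J (X, 0)) (Y, 0)" using that by (simp add: N_J_left L0 N0)
    also have "\<dots> = (0, N2 (phi X) Y) + smul (eta X) (N e (Y, 0))"
      unfolding J0 using that
      by (simp add: N_add_left N_smul_left L0 L_smul e eta_R phi_VF N0)
    finally show ?thesis .
  qed
  have N2_anti: "N2 X Y = - N2 Y X" if "VF X" "VF Y" for X Y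
    using N_anti[OF L0[OF that(1)] L0[OF that(2)]] by (simp add: N2_def)
  have N_e: "fst (N e (Y, 0)) = fscl (N2 \<xi> Y) \<xi>" "snd (N e (Y, 0)) = - N2 0 Y" if "VF Y" for Y
    using N0J[OF xi_VF that] by (simp_all add: phi_xi eta_xi smul_def prod_eq_iff eq_neg_iff_add_eq_0 add.commute)
  have N2_0: "N2 0 Y = 0" if "VF Y" for Y
    using N_smul_left[OF L0[OF VF_zero] L0[OF that] R_zero] by (simp add: N2_def smul_def)
  have N2_xi: "N2 X Y = eta X * N2 \<xi> Y" if "VF X" "VF Y" for X Y
  proof (rule fscl_xi_eq)
    show "fscl (N2 X Y) \<xi> = fscl (eta X * N2 \<xi> Y) \<xi>"
      using arg_cong[OF N0J[OF that], of fst] N_e[OF that(2)] by (simp add: smul_def fscl_linear)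
  qed
  have "N2 \<xi> \<xi> = 0" using N2_anti[OF xi_VF xi_VF] by (auto simp: fun_eq_iff)
  then have "N2 \<xi> Y = 0" if "VF Y" for Y
    using N2_anti[OF xi_VF that] N2_xi[OF that xi_VF] by simp
  then have N2: "N2 X Y = 0" if "VF X" "VF Y" for X Y using N2_xi[OF that] that by simp
  have decomp: "s = (fst s, 0) + smul (snd s) e" for s
    by (simp add: smul_def e_def)
  have split: "N s t = N (fst s, 0) t + smul (snd s) (N e t)" if "s \<in> L" "t \<in> L" for s t
  proof -
    have s: "VF (fst s)" "snd s \<in> R" using that by (simp_all add: L_iff)
    have "N s t = N ((fst s, 0) + smul (snd s) e) t" using decomp[of s] by simp
    also have "\<dots> = N (fst s, 0) t + smul (snd s) (N e t)"
      using that s by (simp add: N_add_left N_smul_left L0 e L_smul)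
    finally show ?thesis .
  qed
  have smul_zero: "smul h 0 = 0" for h :: "'a \<Rightarrow> real" by (simp add: smul_def zero_prod_def)
  have Ne0: "N e (Y, 0) = 0" if "VF Y" for Y
    using N_e[OF that] that by (simp add: N2 N2_0 xi_VF prod_eq_iff)
  have "N e e = 0" by (rule eq_uminus_self[OF N_anti[OF e e]])
  have Ne: "N e t = 0" if "t \<in> L" for t
  proof -
    have t: "VF (fst t)" using that by (simp add: L_iff)
    have "N (fst t, 0) e = 0" using N_anti[OF L0[OF t] e] Ne0[OF t] by simp
    then show ?thesis
      using N_anti[OF e that] split[OF that e] \<open>N e e = 0\<close> by (simp add: smul_zero)
  qed
  have NX: "N (X, 0) t = 0" if "VF X" "t \<in> L" for X t
  proof -
    have t: "VF (fst t)" using that by (simp add: L_iff)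
    have "N (fst t, 0) (X, 0) = 0" using N0[OF t that(1)] N2[OF t that(1)] by (simp add: zero_prod_def)
    then show ?thesis
      using N_anti[OF L0[OF that(1)] that(2)] split[OF that(2) L0[OF that(1)]] Ne[OF L0[OF that(1)]]
      by (simp add: smul_zero)
  qed
  show "\<forall>s\<in>L. \<forall>t\<in>L. N s t = 0"
  proof (intro ballI)
    fix s t assume st: "s \<in> L" "t \<in> L"
    show "N s t = 0"
      using split[OF st] NX[OF _ st(2), of "fst s"] Ne[OF st(2)] st(1) by (simp add: L_iff smul_zero)
  qed
qed

section \<open>Sections of \<open>E\<close> and integrability\<close>

lemma J_endo_at: "J_endo \<phi> \<xi> \<eta> p (at_pt2 s p) = at_pt2 (J s) p"
  by (simp add: J_endo_def at_pt2_def J_def)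

lemma pairing_at: "pairing (at_pt2 w p) (at_pt2 s p) = it1 s w p"
  by (simp add: pairing_def at_pt2_def it1_alt)

text \<open>
  A complex section is in \<open>F\<close> when its real part is \<open>J\<close> of its imaginary part. A pair
  \<open>a + \<i> b\<close> annihilates \<open>Jx + \<i> x\<close> when \<open>b(x) = a(Jx)\<close> and \<open>a(x) = - b(Jx)\<close>; the second equation is the
  first one at \<open>Jx\<close>, since \<open>J\<^sup>2 = - 1\<close>.
\<close>

lemma E_section_iff:
  "Cx \<sigma> \<tau> \<in> sections_of A (E_bundle A \<phi> \<xi> \<eta>) \<longleftrightarrow>
    \<sigma> \<in> e1_sections A \<and> \<tau> \<in> e1_sections A \<and> fst \<sigma> = J (fst \<tau>) \<and>
    (\<forall>x\<in>L. it1 x (snd \<tau>) = it1 (J x) (snd \<sigma>))"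
proof (cases "\<sigma> \<in> e1_sections A \<and> \<tau> \<in> e1_sections A")
  case False
  then show ?thesis by (auto simp: sections_of_def simp del: split_paired_Ex)
next
  case True
  then have st: "fst \<sigma> \<in> L" "fst \<tau> \<in> L" "snd \<sigma> \<in> Lstar" "snd \<tau> \<in> Lstar"
    by (simp_all add: e1_sections_iff)
  have F: "Cx (at_pt2 (fst \<sigma>) p) (at_pt2 (fst \<tau>) p) \<in> F_bundle A \<phi> \<xi> \<eta> p
      \<longleftrightarrow> at_pt2 (fst \<sigma>) p = at_pt2 (J (fst \<tau>)) p" for p
  proof
    assume "at_pt2 (fst \<sigma>) p = at_pt2 (J (fst \<tau>)) p"
    then show "Cx (at_pt2 (fst \<sigma>) p) (at_pt2 (fst \<tau>) p) \<in> F_bundle A \<phi> \<xi> \<eta> p"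
      unfolding F_bundle_def using st(2)
      by (intro CollectI exI[of _ "fst \<tau>"]) (simp add: J_endo_at)
  qed (auto simp: F_bundle_def J_endo_at[symmetric])
  have at_cot: "at_pt2 w p \<in> cotangent_space A p \<times> UNIV" if "w \<in> Lstar" for w p
    using that by (simp add: at_pt2_def Lstar_iff OF1_T)
  have A: "Cx (at_pt2 (snd \<sigma>) p) (at_pt2 (snd \<tau>) p) \<in> Ann A (F_bundle A \<phi> \<xi> \<eta>) p
      \<longleftrightarrow> (\<forall>x\<in>L. it1 (J x) (snd \<sigma>) p - it1 x (snd \<tau>) p = 0 \<and> it1 x (snd \<sigma>) p + it1 (J x) (snd \<tau>) p = 0)"
    for p
  proof -
    have "Cx (at_pt2 (snd \<sigma>) p) (at_pt2 (snd \<tau>) p) \<in> Ann A (F_bundle A \<phi> \<xi> \<eta>) p \<longleftrightarrow>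
        (\<forall>u\<in>F_bundle A \<phi> \<xi> \<eta> p. pairing_C (Cx (at_pt2 (snd \<sigma>) p) (at_pt2 (snd \<tau>) p)) u = 0)"
      using at_cot[OF st(3), of p] at_cot[OF st(4), of p]
      by (auto simp: Ann_def simp del: mem_Sigma_iff split_paired_Ex split_paired_All)
    also have "\<dots> \<longleftrightarrow> (\<forall>x\<in>L. pairing_C (Cx (at_pt2 (snd \<sigma>) p) (at_pt2 (snd \<tau>) p))
        (Cx (at_pt2 (J x) p) (at_pt2 x p)) = 0)"
      unfolding F_bundle_def J_endo_at by blast
    finally show ?thesis by (simp add: pairing_at Complex_eq_0)
  qed
  have E: "Cx (e1_at \<sigma> p) (e1_at \<tau> p) \<in> E_bundle A \<phi> \<xi> \<eta> p \<longleftrightarrow>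
      Cx (at_pt2 (fst \<sigma>) p) (at_pt2 (fst \<tau>) p) \<in> F_bundle A \<phi> \<xi> \<eta> p \<and>
      Cx (at_pt2 (snd \<sigma>) p) (at_pt2 (snd \<tau>) p) \<in> Ann A (F_bundle A \<phi> \<xi> \<eta>) p" for p
    by (auto simp: E_bundle_def direct_sum_def e1_at_def simp del: split_paired_Ex)
  have "Cx \<sigma> \<tau> \<in> sections_of A (E_bundle A \<phi> \<xi> \<eta>) \<longleftrightarrow> (\<forall>p. Cx (e1_at \<sigma> p) (e1_at \<tau> p) \<in> E_bundle A \<phi> \<xi> \<eta> p)"
    using True by (auto simp: sections_of_def simp del: split_paired_Ex)
  also have "\<dots> \<longleftrightarrow> (\<forall>p. at_pt2 (fst \<sigma>) p = at_pt2 (J (fst \<tau>)) p) \<and>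
      (\<forall>x\<in>L. it1 x (snd \<tau>) = it1 (J x) (snd \<sigma>) \<and> it1 x (snd \<sigma>) = - it1 (J x) (snd \<tau>))"
    unfolding E F A by (auto simp: fun_eq_iff eq_neg_iff_add_eq_0)
  also have "(\<forall>p. at_pt2 (fst \<sigma>) p = at_pt2 (J (fst \<tau>)) p) \<longleftrightarrow> fst \<sigma> = J (fst \<tau>)"
    by (auto simp: at_pt2_def prod_eq_iff fun_eq_iff)
  also have "(\<forall>x\<in>L. it1 x (snd \<tau>) = it1 (J x) (snd \<sigma>) \<and> it1 x (snd \<sigma>) = - it1 (J x) (snd \<tau>))
      \<longleftrightarrow> (\<forall>x\<in>L. it1 x (snd \<tau>) = it1 (J x) (snd \<sigma>))"
  proof -
    have "it1 x (snd \<sigma>) = - it1 (J x) (snd \<tau>)"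
      if "x \<in> L" "\<forall>x\<in>L. it1 x (snd \<tau>) = it1 (J x) (snd \<sigma>)" for x
      using that(2)[rule_format, OF J_L[OF that(1)]] st(3) that(1) by (simp add: J_J it1_uminus)
    then show ?thesis by blast
  qed
  finally show ?thesis using True by simp
qed

text \<open>
  If \<open>E\<close> is involutive, the brackets of the sections \<open>Js + \<i> s\<close> without cotangent part give \<open>N = 0\<close>.
  Conversely, \<open>N = 0\<close> says that \<open>F\<close> is involutive. Then the bracket of two sections of \<open>E\<close>, evaluated
  on \<open>F\<close> by \<open>it1_courant\<close>, involves only the pairing of annihilators of \<open>F\<close> with sections of \<open>F\<close>
  and with brackets of sections of \<open>F\<close>, all of which vanish. In the proof, this is the comparison of
  the real part at \<open>J x\<close> with the imaginary part at \<open>x\<close>, by \<open>E_section_iff\<close>.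
\<close>

lemma integrable_iff: "integrable_bundle A (E_bundle A \<phi> \<xi> \<eta>) \<longleftrightarrow> (\<forall>s\<in>L. \<forall>t\<in>L. N s t = 0)"
proof
  assume int: "integrable_bundle A (E_bundle A \<phi> \<xi> \<eta>)"
  show "\<forall>s\<in>L. \<forall>t\<in>L. N s t = 0"
  proof (intro ballI)
    fix s t assume st: "s \<in> L" "t \<in> L"
    have sec: "Cx (J s, 0) (s, 0) \<in> sections_of A (E_bundle A \<phi> \<xi> \<eta>)" if "s \<in> L" for s
      using that by (simp add: E_section_iff e1_sections_iff J_L Lstar_zero it1_zero_right)
    have "courant_C A (Cx (J s, 0) (s, 0)) (Cx (J t, 0) (t, 0)) \<in> sections_of A (E_bundle A \<phi> \<xi> \<eta>)"
      using int sec st unfolding integrable_bundle_def by blast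
    then have "tr_bracket (J s) (J t) - tr_bracket s t = J (tr_bracket (J s) t + tr_bracket s (J t))"
      by (simp add: E_section_iff courant_fst)
    then show "N s t = 0"
      using st by (simp add: N_def J_add L_bracket J_L)
  qed
next
  assume N: "\<forall>s\<in>L. \<forall>t\<in>L. N s t = 0"
  have NE: "tr_bracket (J s) (J t) = tr_bracket s t + J (tr_bracket (J s) t) + J (tr_bracket s (J t))"
    if "s \<in> L" "t \<in> L" for s t
    using N that unfolding N_def by (simp add: algebra_simps)
  show "integrable_bundle A (E_bundle A \<phi> \<xi> \<eta>)"
    unfolding integrable_bundle_def
  proof (intro ballI)
    fix S T assume S: "S \<in> sections_of A (E_bundle A \<phi> \<xi> \<eta>)" and T: "T \<in> sections_of A (E_bundle A \<phi> \<xi> \<eta>)"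
    obtain u a' v b where Sx: "S = Cx (u, a') (v, b)"
      by (cases S; cases "re_part S"; cases "im_part S") auto
    obtain u' c v' d where Tx: "T = Cx (u', c) (v', d)"
      by (cases T; cases "re_part T"; cases "im_part T") auto
    have S': "u = J v" "v \<in> L" "a' \<in> Lstar" "b \<in> Lstar" "\<And>x. x \<in> L \<Longrightarrow> it1 (J x) a' = it1 x b"
      using S by (auto simp: Sx E_section_iff e1_sections_iff)
    have T': "u' = J v'" "v' \<in> L" "c \<in> Lstar" "d \<in> Lstar" "\<And>x. x \<in> L \<Longrightarrow> it1 (J x) c = it1 x d"
      using T by (auto simp: Tx E_section_iff e1_sections_iff)
    have b: "it1 (J x) b = - it1 x a'" if "x \<in> L" for x
      using S'(5)[OF J_L[OF that]] that S'(3) by (simp add: J_J it1_uminus)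
    have d: "it1 (J x) d = - it1 x c" if "x \<in> L" for x
      using T'(5)[OF J_L[OF that]] that T'(3) by (simp add: J_J it1_uminus)
    have sec: "(J v, a') \<in> e1_sections A" "(v, b) \<in> e1_sections A" "(J v', c) \<in> e1_sections A" "(v', d) \<in> e1_sections A"
      using S' T' by (simp_all add: e1_sections_iff J_L)
    let ?P = "courant A (J v, a') (J v', c) - courant A (v, b) (v', d)"
    let ?Q = "courant A (J v, a') (v', d) + courant A (v, b) (J v', c)"
    have "?P \<in> e1_sections A" "?Q \<in> e1_sections A"
      using courant_sections sec by (simp_all add: e1_sections_iff L_add L_diff Lstar_add Lstar_diff)
    moreover have "fst ?P = J (fst ?Q)"
      using S' T' by (simp add: courant_fst NE J_add L_bracket J_L)
    moreover have "it1 x (snd ?Q) = it1 (J x) (snd ?P)" if x: "x \<in> L" for x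
    proof -
      \<comment> \<open>Involutivity of \<open>F\<close>, paired with the two annihilators.\<close>
      have 1: "it1 (tr_bracket (J v) (J x)) c = it1 (tr_bracket v x) c
          + it1 (tr_bracket (J v) x) d + it1 (tr_bracket v (J x)) d"
        using S' T' x by (simp add: NE it1_add L_add L_bracket J_L)
      have 2: "it1 (tr_bracket (J v') (J x)) a' = it1 (tr_bracket v' x) a'
          + it1 (tr_bracket (J v') x) b + it1 (tr_bracket v' (J x)) b"
        using S' T' x by (simp add: NE it1_add L_add L_bracket J_L)
      have R: "it1 x a' \<in> R" "it1 x c \<in> R" "it1 v' a' \<in> R" using S' T' x by (simp_all add: it1_R)
      show ?thesis
        using S'(2-5) T'(2-5) x sec R
        by (simp add: it1_add_right it1_diff_right it1_courant J_L 1 2 b d twd_uminus)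
    qed
    ultimately show "courant_C A S T \<in> sections_of A (E_bundle A \<phi> \<xi> \<eta>)"
      by (simp add: Sx Tx S'(1) T'(1) E_section_iff)
  qed
qed

end

theorem theorem5p3:
  fixes A :: "('a::{t2_space, second_countable_topology}, 'e::euclidean_space) chart set"
    and n :: nat
    and \<phi> :: "'a \<Rightarrow> 'a tvec \<Rightarrow> 'a tvec"
    and \<xi> :: "'a \<Rightarrow> 'a tvec"
    and \<eta> :: "'a \<Rightarrow> 'a covec"
  assumes "smooth_manifold A"
    and "DIM('e) = 2 * n + 1"
    and "almost_contact A \<phi> \<xi> \<eta>"
  shows "normal_almost_contact A \<phi> \<xi> \<eta> \<longleftrightarrow> integrable_bundle A (E_bundle A \<phi> \<xi> \<eta>)"
proof -
  interpret almost_contact_mfd A \<phi> \<xi> \<eta>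
    using assms by unfold_locales
  show ?thesis unfolding normal_iff integrable_iff ..
qed

end
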